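(* Let $d,N\ge 1$ be integers, let $\vec M_1,\dots,\vec M_N\in\mathbb{Z}^d$ be pairwise distinct, and let $Q=\bigcup_{p=1}^N (Q_0+\vec M_p)$ with $Q_0=[-\tfrac12,\tfrac12)^d$. Let $\vec\delta_1,\dots,\vec\delta_N\in\mathbb{R}^d$ and let $\mathcal{B}=\mathcal{B}(\vec\delta_1,\dots,\vec\delta_N)=\bigcup_{j=1}^N\{e^{2\pi i\langle \vec n+\vec\delta_j,\,x\rangle}\}_{\vec n\in\mathbb{Z}^d}$. Then $\mathcal{B}$ is a Riesz basis of $L^2(Q)$ if and only if the $N\times N$ matrix $\mathbf{\Gamma}=\{e^{2\pi i\langle\vec\delta_j,\vec M_p\rangle}\}_{1\le j,p\le N}$ is nonsingular. In that case, the optimal frame constants of $\mathcal{B}$ are the maximum and minimum singular values of $\mathbf{\Gamma}$ (the maximum being the optimal upper constant and the minimum the optimal lower constant), where the singular values of a matrix $M$ are understood to be the eigenvalues of $M^*M$.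
   Context: The set $\mathcal{B}$ is regarded as a family indexed by $(j,\vec n)\in\{1,\dots,N\}\times\mathbb{Z}^d$ of functions of $x$ restricted to $Q$. A countable family $\{v_k\}$ in a separable Hilbert space $H$ is a frame if there are $A,B>0$ with $A\|w\|^2\le\sum_k|\langle w,v_k\rangle|^2\le B\|w\|^2$ for all $w\in H$; it is a Riesz sequence if there are $A,B>0$ with $A\sum_{k\in J}|a_k|^2\le\|\sum_{k\in J}a_kv_k\|^2\le B\sum_{k\in J}|a_k|^2$ for all finite families $\{a_k\}_{k\in J}$ of complex numbers; it is a Riesz basis if it is both. The optimal frame constants are the largest $A$ and smallest $B$ for which the frame inequality holds. Convention: the singular values of a matrix $M$ are the eigenvalues of $M^*M$ (no square root is taken), where $M^*$ is the conjugate transpose. *)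

theory Defs
  imports "HOL-Analysis.Analysis"
begin

section \<open>The space \<open>L\<^sup>2(\<mu>)\<close>\<close>

text \<open>
  Elements of \<open>L\<^sup>2(\<mu>)\<close> are represented by square-integrable functions instead of classes of
  functions modulo equality almost everywhere. The frame and Riesz conditions below only involve
  \<open>L2_inner\<close> and \<open>L2_norm\<close>, which do not see changes on null sets.
\<close>

definition L2_space :: "'a measure \<Rightarrow> ('a \<Rightarrow> complex) set" where
  "L2_space \<mu> = {f \<in> borel_measurable \<mu>. integrable \<mu> (\<lambda>x. (cmod (f x))\<^sup>2)}"

definition L2_inner :: "'a measure \<Rightarrow> ('a \<Rightarrow> complex) \<Rightarrow> ('a \<Rightarrow> complex) \<Rightarrow> complex" where
  "L2_inner \<mu> f g = (\<integral>x. f x * cnj (g x) \<partial>\<mu>)"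

definition L2_norm :: "'a measure \<Rightarrow> ('a \<Rightarrow> complex) \<Rightarrow> real" where
  "L2_norm \<mu> f = sqrt (Re (L2_inner \<mu> f f))"


section \<open>Frames, Riesz sequences and Riesz bases of \<open>L\<^sup>2(\<mu>)\<close>\<close>

definition L2_family :: "'a measure \<Rightarrow> 'k set \<Rightarrow> ('k \<Rightarrow> 'a \<Rightarrow> complex) \<Rightarrow> bool" where
  "L2_family \<mu> I v \<longleftrightarrow> countable I \<and> (\<forall>k\<in>I. v k \<in> L2_space \<mu>)"

text \<open>
  Convergence of the series is part of the frame inequality and is stated explicitly, since
  \<open>infsum\<close> is \<open>0\<close> for a divergent series.
\<close>

definition frame_constants ::
    "'a measure \<Rightarrow> 'k set \<Rightarrow> ('k \<Rightarrow> 'a \<Rightarrow> complex) \<Rightarrow> real \<Rightarrow> real \<Rightarrow> bool" where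
  "frame_constants \<mu> I v A B \<longleftrightarrow> 0 < A \<and> 0 < B \<and>
     (\<forall>w \<in> L2_space \<mu>.
        (\<lambda>k. (cmod (L2_inner \<mu> w (v k)))\<^sup>2) summable_on I \<and>
        A * (L2_norm \<mu> w)\<^sup>2 \<le> (\<Sum>\<^sub>\<infinity>k\<in>I. (cmod (L2_inner \<mu> w (v k)))\<^sup>2) \<and>
        (\<Sum>\<^sub>\<infinity>k\<in>I. (cmod (L2_inner \<mu> w (v k)))\<^sup>2) \<le> B * (L2_norm \<mu> w)\<^sup>2)"

definition is_frame :: "'a measure \<Rightarrow> 'k set \<Rightarrow> ('k \<Rightarrow> 'a \<Rightarrow> complex) \<Rightarrow> bool" where
  "is_frame \<mu> I v \<longleftrightarrow> L2_family \<mu> I v \<and> (\<exists>A B. frame_constants \<mu> I v A B)"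

definition is_riesz_sequence :: "'a measure \<Rightarrow> 'k set \<Rightarrow> ('k \<Rightarrow> 'a \<Rightarrow> complex) \<Rightarrow> bool" where
  "is_riesz_sequence \<mu> I v \<longleftrightarrow> L2_family \<mu> I v \<and>
     (\<exists>A B. 0 < A \<and> 0 < B \<and>
        (\<forall>J (a :: 'k \<Rightarrow> complex). finite J \<and> J \<subseteq> I \<longrightarrow>
           A * (\<Sum>k\<in>J. (cmod (a k))\<^sup>2) \<le> (L2_norm \<mu> (\<lambda>x. \<Sum>k\<in>J. a k * v k x))\<^sup>2 \<and>
           (L2_norm \<mu> (\<lambda>x. \<Sum>k\<in>J. a k * v k x))\<^sup>2 \<le> B * (\<Sum>k\<in>J. (cmod (a k))\<^sup>2)))"

definition is_riesz_basis :: "'a measure \<Rightarrow> 'k set \<Rightarrow> ('k \<Rightarrow> 'a \<Rightarrow> complex) \<Rightarrow> bool" where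
  "is_riesz_basis \<mu> I v \<longleftrightarrow> is_frame \<mu> I v \<and> is_riesz_sequence \<mu> I v"

definition optimal_frame_constants ::
    "'a measure \<Rightarrow> 'k set \<Rightarrow> ('k \<Rightarrow> 'a \<Rightarrow> complex) \<Rightarrow> real \<Rightarrow> real \<Rightarrow> bool" where
  "optimal_frame_constants \<mu> I v A B \<longleftrightarrow> frame_constants \<mu> I v A B \<and>
     (\<forall>A' B'. frame_constants \<mu> I v A' B' \<longrightarrow> A' \<le> A \<and> B \<le> B')"


section \<open>Eigenvalues and singular values of complex matrices\<close>

definition eigenvalues :: "complex^'n^'n \<Rightarrow> complex set" where
  "eigenvalues A = {c. \<exists>v. v \<noteq> 0 \<and> A *v v = c *s v}"

definition conj_transpose :: "complex^'n^'m \<Rightarrow> complex^'m^'n" where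
  "conj_transpose A = (\<chi> i j. cnj (A $ j $ i))"

text \<open>
  Singular values are taken without the square root. The following lemma shows that no eigenvalue
  of \<open>A\<^sup>* A\<close> is lost by collecting the real ones only.
\<close>

definition singular_values :: "complex^'n^'m \<Rightarrow> real set" where
  "singular_values A = {s. complex_of_real s \<in> eigenvalues (conj_transpose A ** A)}"

lemma eigenvalues_conj_transpose_mult:
  fixes A :: "complex^'n^'m"
  shows "eigenvalues (conj_transpose A ** A) = complex_of_real ` singular_values A"
proof -
  have "c \<in> \<real>" if "c \<in> eigenvalues (conj_transpose A ** A)" for c
  proof -
    from that obtain v where v: "v \<noteq> 0" "(conj_transpose A ** A) *v v = c *s v"
      by (auto simp: eigenvalues_def)
    define w where "w = A *v v"
    define S where "S = (\<Sum>i\<in>UNIV. (cmod (v$i))\<^sup>2)"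
    define T where "T = (\<Sum>i\<in>UNIV. (cmod (w$i))\<^sup>2)"
    have sq: "cnj z * z = (complex_of_real (cmod z))\<^sup>2" for z
      by (metis complex_norm_square mult.commute of_real_power)
    have "c * of_real S = (\<Sum>i\<in>UNIV. cnj (v$i) * (c *s v)$i)"
      unfolding S_def of_real_sum sum_distrib_left
      by (intro sum.cong refl) (simp add: sq[symmetric])
    also have "c *s v = conj_transpose A *v w"
      by (simp add: w_def v(2)[symmetric] matrix_vector_mul_assoc)
    also have "(\<Sum>i\<in>UNIV. cnj (v$i) * (conj_transpose A *v w)$i) =
               (\<Sum>i\<in>UNIV. \<Sum>j\<in>UNIV. cnj (v$i) * cnj (A$j$i) * w$j)"
      by (simp add: matrix_vector_mult_def conj_transpose_def sum_distrib_left mult.assoc)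
    also have "\<dots> = (\<Sum>j\<in>UNIV. cnj (w$j) * w$j)"
    proof (subst sum.swap, rule sum.cong)
      fix j
      have "cnj (w$j) = (\<Sum>i\<in>UNIV. cnj (v$i) * cnj (A$j$i))"
        by (simp add: w_def matrix_vector_mult_def mult.commute)
      thus "(\<Sum>i\<in>UNIV. cnj (v$i) * cnj (A$j$i) * w$j) = cnj (w$j) * w$j"
        by (simp add: sum_distrib_right)
    qed simp
    also have "\<dots> = of_real T"
      by (simp add: T_def sq)
    finally have eq: "c * of_real S = of_real T" .
    obtain i where "v$i \<noteq> 0" using v(1) by (auto simp: vec_eq_iff)
    hence "S > 0"
      unfolding S_def by (intro sum_pos2[of _ i]) auto
    with eq have "c = of_real (T / S)" by (simp add: field_simps)
    thus ?thesis by simp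
  qed
  thus ?thesis by (force simp: singular_values_def elim: Reals_cases)
qed


section \<open>The set \<open>Q\<close>, the exponential family and the matrix \<open>\<Gamma>\<close>\<close>

definition real_vec :: "int^'d \<Rightarrow> real^'d" where
  "real_vec m = (\<chi> i. of_int (m $ i))"

definition Q0 :: "(real^'d) set" where
  "Q0 = {x. \<forall>i. - 1/2 \<le> x $ i \<and> x $ i < 1/2}"

definition Q_union :: "('n \<Rightarrow> int^'d) \<Rightarrow> (real^'d) set" where
  "Q_union M = (\<Union>p. (\<lambda>x. x + real_vec (M p)) ` Q0)"

definition exp_family :: "('n \<Rightarrow> real^'d) \<Rightarrow> 'n \<times> (int^'d) \<Rightarrow> real^'d \<Rightarrow> complex" where
  "exp_family \<delta> = (\<lambda>(j, n) x. exp (2 * pi * \<i> * complex_of_real ((real_vec n + \<delta> j) \<bullet> x)))"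

definition Gamma_matrix :: "('n \<Rightarrow> real^'d) \<Rightarrow> ('n \<Rightarrow> int^'d) \<Rightarrow> complex^'n^'n" where
  "Gamma_matrix \<delta> M = (\<chi> j p. exp (2 * pi * \<i> * complex_of_real (\<delta> j \<bullet> real_vec (M p))))"

end

theory Submission
  imports Defs
begin

text \<open>
  Write \<open>W x\<close> for the vector of the values \<open>f (x + M\<^sub>p)\<close> at the translates of a point \<open>x\<close> of \<open>Q0\<close>.
  Since \<open>n \<bullet> M\<^sub>p\<close> is an integer, the inner products of \<open>f\<close> with the exponentials of index \<open>(j, n)\<close>
  are, for fixed \<open>j\<close>, the Fourier coefficients on \<open>Q0\<close> of a unimodular multiple of the \<open>j\<close>-th entry of
  \<open>\<Gamma> (W x)\<close>, up to complex conjugations. By Parseval's identity the frame sum is therefore the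
  integral of \<open>|\<Gamma> (W x)|\<^sup>2\<close> over \<open>Q0\<close>, whereas \<open>|f|\<^sup>2\<close> is the integral of \<open>|W x|\<^sup>2\<close>. As \<open>W\<close> can be
  any constant vector, the frame constants of the family are exactly the bounds of
  \<open>|\<Gamma> v|\<^sup>2 / |v|\<^sup>2\<close>, whose extreme values are singular values. In the same way the norm of a finite
  linear combination of the exponentials is controlled by the transpose of \<open>\<Gamma>\<close>.
\<close>

section \<open>Extremal singular values\<close>

text \<open>The analytic obstacle is the density of trigonometric polynomials on \<open>Q0\<close>.
  A function of \<open>torus_map x\<close> takes equal values on opposite faces of the closed cube,
  so Stone-Weierstrass is applied on the image of the cube in complex space, where real polynomials
  pull back to trigonometric polynomials; the faces themselves form a null set. Extreme singular
  values come from compactness of the unit sphere: at an extremum of |A v|^2 a semidefinite form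
  vanishes, which turns the extremal vector into an eigenvector. A lower frame bound makes the
  kernel of \<open>Gamma_matrix\<close> trivial; since the matrix is square, it is then invertible
  together with its transpose, on which the Riesz bounds rest.\<close>

lemma inner_complex_vec: "(x::complex^'n) \<bullet> y = Re (\<Sum>i\<in>UNIV. cnj (x$i) * y$i)"
  by (simp add: inner_vec_def inner_complex_def)

text \<open>The real inner product of the type class is the real part of the Hermitian one, so the
  conjugate transpose is the adjoint for it as well. Orthogonality and semidefiniteness can then be
  used as in any real inner product space.\<close>

lemma inner_conj_transpose:
  fixes A :: "complex^'n^'m"
  shows "(conj_transpose A *v w) \<bullet> v = w \<bullet> (A *v v)"
proof -
  have "(\<Sum>i\<in>UNIV. cnj ((conj_transpose A *v w)$i) * v$i)
      = (\<Sum>i\<in>UNIV. \<Sum>j\<in>UNIV. cnj (w$j) * (A$j$i * v$i))"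
    by (simp add: matrix_vector_mult_def conj_transpose_def sum_distrib_left sum_distrib_right mult_ac)
  also have "\<dots> = (\<Sum>j\<in>UNIV. cnj (w$j) * (A *v v)$j)"
    by (subst sum.swap) (simp add: matrix_vector_mult_def sum_distrib_left)
  finally show ?thesis by (simp only: inner_complex_vec)
qed

lemma scaleR_eq_vector_scalar_mult: "c *\<^sub>R (v::complex^'n) = complex_of_real c *s v"
  by (simp add: vec_eq_iff scaleR_conv_of_real[where 'a = complex])

lemma matrix_vector_mult_scaleR_complex: "A *v (c *\<^sub>R (v::complex^'n)) = c *\<^sub>R (A *v v)"
  by (simp add: scaleR_eq_vector_scalar_mult vector_scalar_commute)

lemma linear_matrix_vector_mult_complex: "linear ((*v) (A::complex^'n^'m))"
  by (intro linearI) (simp_all add: matrix_vector_right_distrib matrix_vector_mult_scaleR_complex)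

lemma singular_values_iff:
  "s \<in> singular_values A \<longleftrightarrow> (\<exists>v\<noteq>0. conj_transpose A *v (A *v v) = s *\<^sub>R v)"
  by (simp add: singular_values_def eigenvalues_def scaleR_eq_vector_scalar_mult
      matrix_vector_mul_assoc)

lemma norm_matrix_singular_vector:
  assumes "conj_transpose A *v (A *v v) = s *\<^sub>R (v::complex^'n)"
  shows "(norm (A *v v))\<^sup>2 = s * (norm v)\<^sup>2"
  by (simp add: power2_norm_eq_inner inner_conj_transpose[symmetric] assms)

text \<open>Eigenvectors of a self-adjoint map for distinct eigenvalues are orthogonal, and nonzero
  orthogonal vectors are linearly independent. Finiteness gives \<open>Min\<close> and
  \<open>Max\<close> of the set of singular values their intended meaning.\<close>

lemma finite_singular_values: "finite (singular_values (A::complex^'n^'m))"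
proof -
  have "\<forall>s\<in>singular_values A. \<exists>v. v \<noteq> 0 \<and> conj_transpose A *v (A *v v) = s *\<^sub>R v"
    by (simp add: singular_values_iff Bex_def)
  then obtain v where v: "\<And>s. s \<in> singular_values A \<Longrightarrow> v s \<noteq> 0"
    "\<And>s. s \<in> singular_values A \<Longrightarrow> conj_transpose A *v (A *v v s) = s *\<^sub>R v s"
    by metis
  have orth: "v s \<bullet> v t = 0" if "s \<in> singular_values A" "t \<in> singular_values A" "s \<noteq> t" for s t
  proof -
    have "s * (v s \<bullet> v t) = (conj_transpose A *v (A *v v s)) \<bullet> v t"
      by (simp add: v that)
    also have "\<dots> = (conj_transpose A *v (A *v v t)) \<bullet> v s"
      by (simp only: inner_conj_transpose) (rule inner_commute)
    also have "\<dots> = t * (v s \<bullet> v t)"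
      by (simp add: v that inner_commute)
    finally show ?thesis using that by simp
  qed
  have "pairwise orthogonal (v ` singular_values A)"
    using orth by (auto simp: pairwise_def orthogonal_def)
  moreover have "0 \<notin> v ` singular_values A" using v(1) by auto
  ultimately have "finite (v ` singular_values A)"
    using pairwise_orthogonal_independent independent_imp_finite by blast
  \<comment> \<open>A common eigenvector of two distinct values would be orthogonal to itself;
    injectivity carries finiteness from the eigenvectors back to the values.\<close>
  moreover have "inj_on v (singular_values A)"
    using orth v(1) by (intro inj_onI) (metis inner_eq_zero_iff)
  ultimately show ?thesis using finite_imageD by blast
qed

text \<open>A zero of a nonnegative quadratic form is a minimum, and \<open>2 *\<^sub>R T v\<close> is the gradient at \<open>v\<close>.\<close>

lemma psd_form_kernel:
  fixes T :: "'a::real_inner \<Rightarrow> 'a"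
  assumes "linear T" and sym: "\<And>x y. T x \<bullet> y = x \<bullet> T y"
    and nonneg: "\<And>x. 0 \<le> T x \<bullet> x" and "T v \<bullet> v = 0"
  shows "T v = 0"
proof (rule ccontr)
  assume "T v \<noteq> 0"
  define u where "u = T v"
  define a where "a = u \<bullet> u"
  define b where "b = T u \<bullet> u"
  have "a > 0" using \<open>T v \<noteq> 0\<close> by (simp add: a_def u_def)
  have "b \<ge> 0" by (simp add: b_def nonneg)
  have *: "0 \<le> 2 * t * a + t\<^sup>2 * b" for t
  proof -
    have "0 \<le> T (v + t *\<^sub>R u) \<bullet> (v + t *\<^sub>R u)" by (rule nonneg)
    also have "\<dots> = 2 * t * a + t\<^sup>2 * b"
      using \<open>T v \<bullet> v = 0\<close> sym[of u v]
      by (simp add: linear_add[OF \<open>linear T\<close>] linear_scale[OF \<open>linear T\<close>] inner_simps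
          a_def b_def u_def[symmetric] power2_eq_square algebra_simps)
    finally show ?thesis .
  qed
  \<comment> \<open>A small negative parameter lets the linear term win over the quadratic one. The
    minimiser would be -a / b; the denominator b + 1 keeps the choice valid for b = 0.\<close>
  have "0 \<le> 2 * (- a / (b + 1)) * a + (- a / (b + 1))\<^sup>2 * b" by (rule *)
  also have "\<dots> = - (a\<^sup>2 / (b + 1)\<^sup>2) * (b + 2)"
    using \<open>b \<ge> 0\<close> by (simp add: divide_simps power2_eq_square) (simp add: algebra_simps)
  also have "\<dots> < 0"
    using \<open>a > 0\<close> \<open>b \<ge> 0\<close> by (simp add: mult_neg_pos)
  finally show False by simp
qed

text \<open>The form |A v|^2 has a minimiser x and a maximiser z on the compact unit sphere. The
  forms of \<open>T - q x\<close> and \<open>q z - T\<close> are nonnegative by homogeneity and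
  vanish at x and at z, so \<open>psd_form_kernel\<close> makes x and z eigenvectors of
  \<open>T\<close>.\<close>

lemma extremal_singular_values:
  fixes A :: "complex^'n^'m"
  obtains s t where "s \<in> singular_values A" "t \<in> singular_values A"
    "\<And>v. s * (norm v)\<^sup>2 \<le> (norm (A *v v))\<^sup>2" "\<And>v. (norm (A *v v))\<^sup>2 \<le> t * (norm v)\<^sup>2"
proof -
  define q where "q v = (norm (A *v v))\<^sup>2" for v
  define T where "T v = conj_transpose A *v (A *v v)" for v
  have Tq: "T v \<bullet> v = q v" for v
    by (simp add: T_def q_def inner_conj_transpose power2_norm_eq_inner)
  then have Tq': "v \<bullet> T v = q v" for v by (simp add: inner_commute)
  have symT: "T v \<bullet> u = v \<bullet> T u" for u v
    by (simp add: T_def inner_conj_transpose) (metis inner_commute inner_conj_transpose)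
  have linT: "linear T"
    unfolding T_def by (rule linear_compose[OF linear_matrix_vector_mult_complex
          linear_matrix_vector_mult_complex, unfolded o_def])
  have cont: "continuous_on (sphere 0 1) q"
    unfolding q_def by (intro continuous_intros linear_continuous_on_compose
        linear_matrix_vector_mult_complex continuous_on_id)
  obtain e :: "complex^'n" where "norm e = 1"
    using vector_choose_size[of 1] by auto
  then have ne: "sphere (0::complex^'n) 1 \<noteq> {}" by auto
  obtain x where x: "norm x = 1" "\<And>y. norm y = 1 \<Longrightarrow> q x \<le> q y"
    using continuous_attains_inf[OF compact_sphere ne cont] by auto
  obtain z where z: "norm z = 1" "\<And>y. norm y = 1 \<Longrightarrow> q y \<le> q z"
    using continuous_attains_sup[OF compact_sphere ne cont] by auto
  have scale: "q v = (norm v)\<^sup>2 * q (v /\<^sub>R norm v)" for v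
    by (cases "v = 0") (simp_all add: q_def matrix_vector_mult_scaleR_complex power_mult_distrib
        flip: power_mult_distrib[of "norm v"])
  have lower: "q x * (norm v)\<^sup>2 \<le> q v" for v
    using x(2)[of "v /\<^sub>R norm v"] scale[of v]
    by (cases "v = 0") (auto simp: mult.commute q_def mult_left_mono)
  have upper: "q v \<le> q z * (norm v)\<^sup>2" for v
    using z(2)[of "v /\<^sub>R norm v"] scale[of v]
    by (cases "v = 0") (auto simp: mult.commute q_def mult_left_mono)
  have "T x - q x *\<^sub>R x = 0"
    using lower by (intro psd_form_kernel[of "\<lambda>v. T v - q x *\<^sub>R v"])
      (auto simp: linear_compose_sub linT linear_scale_self symT inner_simps Tq'
        x(1) dot_square_norm)
  moreover have "q z *\<^sub>R z - T z = 0"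
    using upper by (intro psd_form_kernel[of "\<lambda>v. q z *\<^sub>R v - T v"])
      (auto simp: linear_compose_sub linT linear_scale_self symT inner_simps Tq'
        z(1) dot_square_norm)
  moreover have "x \<noteq> 0" "z \<noteq> 0" using x(1) z(1) by auto
  ultimately have "q x \<in> singular_values A" "q z \<in> singular_values A"
    by (auto simp: singular_values_iff T_def intro: exI[of _ x] exI[of _ z])
  then show ?thesis using that lower upper unfolding q_def by blast
qed

text \<open>The bounds s and t of \<open>extremal_singular_values\<close> are themselves singular
  values, so \<open>Min\<close> is at most s and \<open>Max\<close> at least t, and replacing them
  only weakens the inequalities.\<close>

lemma singular_value_bounds:
  fixes A :: "complex^'n^'m"
  shows "Min (singular_values A) \<in> singular_values A"
    and "Max (singular_values A) \<in> singular_values A"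
    and "Min (singular_values A) * (norm v)\<^sup>2 \<le> (norm (A *v v))\<^sup>2"
    and "(norm (A *v v))\<^sup>2 \<le> Max (singular_values A) * (norm v)\<^sup>2"
proof -
  obtain s t where st: "s \<in> singular_values A" "t \<in> singular_values A"
    "\<And>v. s * (norm v)\<^sup>2 \<le> (norm (A *v v))\<^sup>2" "\<And>v. (norm (A *v v))\<^sup>2 \<le> t * (norm v)\<^sup>2"
    using extremal_singular_values[of A] by metis
  note fin = finite_singular_values[of A]
  show "Min (singular_values A) \<in> singular_values A" "Max (singular_values A) \<in> singular_values A"
    using st fin by (auto intro: Min_in Max_in)
  show "Min (singular_values A) * (norm v)\<^sup>2 \<le> (norm (A *v v))\<^sup>2"
    by (rule order_trans[OF mult_right_mono st(3)]) (use st fin in auto)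
  show "(norm (A *v v))\<^sup>2 \<le> Max (singular_values A) * (norm v)\<^sup>2"
    by (rule order_trans[OF st(4) mult_right_mono]) (use st fin in auto)
qed

lemma invertible_complex_iff:
  "invertible (A::complex^'n^'n) \<longleftrightarrow> (\<forall>v. A *v v = 0 \<longrightarrow> v = 0)"
  by (simp add: invertible_left_inverse matrix_left_invertible_ker)

section \<open>Parseval's identity for a dense orthonormal family\<close>

lemma L2_space_iff: "f \<in> L2_space \<mu> \<longleftrightarrow> f \<in> borel_measurable \<mu> \<and> integrable \<mu> (\<lambda>x. (cmod (f x))\<^sup>2)"
  by (simp add: L2_space_def)

lemma cmod_add_squared_le: "(cmod (a + b))\<^sup>2 \<le> 2 * (cmod a)\<^sup>2 + 2 * (cmod b)\<^sup>2"
proof -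
  have "(cmod (a + b))\<^sup>2 \<le> (cmod a + cmod b)\<^sup>2"
    by (intro power_mono norm_triangle_ineq) simp
  also have "\<dots> \<le> 2 * (cmod a)\<^sup>2 + 2 * (cmod b)\<^sup>2"
    using zero_le_power2[of "cmod a - cmod b"] by (simp add: power2_eq_square algebra_simps)
  finally show ?thesis .
qed

lemma L2_space_add:
  assumes "f \<in> L2_space \<mu>" "g \<in> L2_space \<mu>"
  shows "(\<lambda>x. f x + g x) \<in> L2_space \<mu>"
proof -
  have [measurable]: "f \<in> borel_measurable \<mu>" "g \<in> borel_measurable \<mu>"
    and int: "integrable \<mu> (\<lambda>x. 2 * (cmod (f x))\<^sup>2 + 2 * (cmod (g x))\<^sup>2)"
    using assms by (auto simp: L2_space_iff)
  have "integrable \<mu> (\<lambda>x. (cmod (f x + g x))\<^sup>2)"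
    by (rule Bochner_Integration.integrable_bound[OF int])
       (use cmod_add_squared_le in \<open>auto intro!: AE_I2 intro: order_trans\<close>)
  then show ?thesis by (simp add: L2_space_iff)
qed

lemma L2_space_scale: "f \<in> L2_space \<mu> \<Longrightarrow> (\<lambda>x. c * f x) \<in> L2_space \<mu>"
  by (auto simp: L2_space_iff norm_mult power_mult_distrib)

lemma L2_space_diff:
  assumes "f \<in> L2_space \<mu>" "g \<in> L2_space \<mu>"
  shows "(\<lambda>x. f x - g x) \<in> L2_space \<mu>"
  using L2_space_add[OF assms(1) L2_space_scale[OF assms(2), of "-1"]] by simp

lemma L2_space_sum:
  "(\<And>i. i \<in> I \<Longrightarrow> f i \<in> L2_space \<mu>) \<Longrightarrow> (\<lambda>x. \<Sum>i\<in>I. f i x) \<in> L2_space \<mu>"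
proof (induction I rule: infinite_finite_induct)
  case (insert i I)
  then show ?case by (simp add: L2_space_add)
qed (auto simp: L2_space_iff)

lemma L2_space_bounded:
  assumes "finite_measure \<mu>" and [measurable]: "f \<in> borel_measurable \<mu>"
    and "\<And>x. x \<in> space \<mu> \<Longrightarrow> cmod (f x) \<le> B"
  shows "f \<in> L2_space \<mu>"
proof -
  have "norm ((cmod (f x))\<^sup>2) \<le> B\<^sup>2" if "x \<in> space \<mu>" for x
    using assms(3)[OF that] by (simp add: power_mono)
  then have "integrable \<mu> (\<lambda>x. (cmod (f x))\<^sup>2)"
    by (intro finite_measure.integrable_const_bound[OF assms(1), of _ "B\<^sup>2"] AE_I2) auto
  then show ?thesis by (simp add: L2_space_iff)
qed

lemma integrable_L2_inner:
  assumes "f \<in> L2_space \<mu>" "g \<in> L2_space \<mu>"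
  shows "integrable \<mu> (\<lambda>x. f x * cnj (g x))"
proof -
  have [measurable]: "f \<in> borel_measurable \<mu>" "g \<in> borel_measurable \<mu>"
    and int: "integrable \<mu> (\<lambda>x. (cmod (f x))\<^sup>2 + (cmod (g x))\<^sup>2)"
    using assms by (auto simp: L2_space_iff)
  have le: "cmod a * cmod b \<le> (cmod a)\<^sup>2 + (cmod b)\<^sup>2" for a b :: complex
    using sum_squares_bound[of "cmod a" "cmod b"]
      mult_nonneg_nonneg[OF norm_ge_zero[of a] norm_ge_zero[of b]] by linarith
  have [measurable]: "(\<lambda>x. cnj (g x)) \<in> borel_measurable \<mu>"
    by (rule measurable_compose[of g _ borel])
       (auto intro!: borel_measurable_continuous_onI continuous_intros)
  show ?thesis
    by (rule Bochner_Integration.integrable_bound[OF int])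
       (use le in \<open>auto simp: norm_mult\<close>)
qed

lemma L2_inner_self: "L2_inner \<mu> f f = of_real (\<integral>x. (cmod (f x))\<^sup>2 \<partial>\<mu>)"
  unfolding L2_inner_def by (simp add: complex_norm_square[symmetric] flip: of_real_power)

lemma L2_norm_squared: "(L2_norm \<mu> f)\<^sup>2 = (\<integral>x. (cmod (f x))\<^sup>2 \<partial>\<mu>)"
  by (simp add: L2_norm_def L2_inner_self)

lemma cnj_L2_inner: "cnj (L2_inner \<mu> f g) = L2_inner \<mu> g f"
  unfolding L2_inner_def by (simp add: mult.commute flip: Bochner_Integration.integral_cnj)

lemma L2_inner_sum_left:
  assumes "\<And>i. i \<in> I \<Longrightarrow> f i \<in> L2_space \<mu>" "g \<in> L2_space \<mu>"
  shows "L2_inner \<mu> (\<lambda>x. \<Sum>i\<in>I. a i * f i x) g = (\<Sum>i\<in>I. a i * L2_inner \<mu> (f i) g)"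
proof -
  have "L2_inner \<mu> (\<lambda>x. \<Sum>i\<in>I. a i * f i x) g = (\<integral>x. (\<Sum>i\<in>I. a i * (f i x * cnj (g x))) \<partial>\<mu>)"
    by (simp add: L2_inner_def sum_distrib_right mult.assoc)
  also have "\<dots> = (\<Sum>i\<in>I. a i * L2_inner \<mu> (f i) g)"
    unfolding L2_inner_def
    by (subst Bochner_Integration.integral_sum) (auto intro!: integrable_mult_right integrable_L2_inner assms)
  finally show ?thesis .
qed

lemma integral_norm_diff_squared:
  assumes f: "f \<in> L2_space \<mu>" and g: "g \<in> L2_space \<mu>"
  shows "(\<integral>x. (cmod (f x - g x))\<^sup>2 \<partial>\<mu>)
    = (\<integral>x. (cmod (f x))\<^sup>2 \<partial>\<mu>) - 2 * Re (L2_inner \<mu> f g) + (\<integral>x. (cmod (g x))\<^sup>2 \<partial>\<mu>)"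
proof -
  have *: "(cmod (a - b))\<^sup>2 = (cmod a)\<^sup>2 - 2 * Re (a * cnj b) + (cmod b)\<^sup>2" for a b
    by (simp add: cmod_power2 power2_diff)
  have int: "integrable \<mu> (\<lambda>x. (cmod (f x))\<^sup>2)" "integrable \<mu> (\<lambda>x. (cmod (g x))\<^sup>2)"
    "integrable \<mu> (\<lambda>x. Re (f x * cnj (g x)))"
    using integrable_L2_inner[OF f g] f g integrable_Re[OF integrable_L2_inner[OF f g]]
    by (auto simp: L2_space_iff)
  have Re: "Re (L2_inner \<mu> f g) = (\<integral>x. Re (f x * cnj (g x)) \<partial>\<mu>)"
    unfolding L2_inner_def by (rule integral_Re[symmetric]) (rule integrable_L2_inner[OF f g])
  show ?thesis unfolding Re using int by (simp only: *) (simp del: times_complex.sel)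
qed

section \<open>Pythagoras, Bessel and Parseval\<close>

lemma integral_orthonormal_combination:
  assumes e: "\<And>n. e n \<in> L2_space \<mu>"
    and on: "\<And>m n. L2_inner \<mu> (e m) (e n) = (if m = n then 1 else 0)"
    and "finite J"
  shows "(\<integral>x. (cmod (\<Sum>n\<in>J. a n * e n x))\<^sup>2 \<partial>\<mu>) = (\<Sum>n\<in>J. (cmod (a n))\<^sup>2)"
proof -
  define t where "t x = (\<Sum>n\<in>J. a n * e n x)" for x
  have t: "t \<in> L2_space \<mu>"
    unfolding t_def by (intro L2_space_sum L2_space_scale e)
  have te: "L2_inner \<mu> t (e n) = a n" if "n \<in> J" for n
  proof -
    have "L2_inner \<mu> t (e n) = (\<Sum>m\<in>J. a m * L2_inner \<mu> (e m) (e n))"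
      unfolding t_def by (rule L2_inner_sum_left) (auto intro: e)
    also have "\<dots> = a n" using that \<open>finite J\<close> by (simp add: on if_distrib[of "(*) _"] cong: if_cong)
    finally show ?thesis .
  qed
  have "L2_inner \<mu> t t = (\<Sum>n\<in>J. a n * L2_inner \<mu> (e n) t)"
    by (subst (1) t_def[abs_def]) (rule L2_inner_sum_left, auto intro: e t)
  also have "\<dots> = (\<Sum>n\<in>J. a n * cnj (a n))"
    by (intro sum.cong refl) (metis te cnj_L2_inner)
  finally have "complex_of_real (\<integral>x. (cmod (t x))\<^sup>2 \<partial>\<mu>) = of_real (\<Sum>n\<in>J. (cmod (a n))\<^sup>2)"
    by (simp only: L2_inner_self of_real_sum complex_norm_square)
  then show ?thesis by (simp only: of_real_eq_iff t_def)
qed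

text \<open>Parseval's identity needs density of finite linear combinations only, not completeness of
  the space: the orthogonal projection onto a finite subfamily is at least as close to \<open>f\<close> as any
  other combination of the same elements.\<close>

lemma parseval_of_dense:
  assumes e: "\<And>n. e n \<in> L2_space \<mu>"
    and on: "\<And>m n. L2_inner \<mu> (e m) (e n) = (if m = n then 1 else 0)"
    and f: "f \<in> L2_space \<mu>"
    and dense: "\<And>\<epsilon>. \<epsilon> > 0 \<Longrightarrow> \<exists>J a. finite J \<and> (\<integral>x. (cmod (f x - (\<Sum>n\<in>J. a n * e n x)))\<^sup>2 \<partial>\<mu>) < \<epsilon>"
  shows "((\<lambda>n. (cmod (L2_inner \<mu> f (e n)))\<^sup>2) has_sum (\<integral>x. (cmod (f x))\<^sup>2 \<partial>\<mu>)) UNIV"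
proof -
  define c where "c n = L2_inner \<mu> f (e n)" for n
  define S where "S = (\<integral>x. (cmod (f x))\<^sup>2 \<partial>\<mu>)"
  \<comment> \<open>Completing the square isolates the error of the coefficients. The choice a = c
    gives Bessel's inequality, and for every other choice the last sum is nonnegative, so the
    projection is at least as close.\<close>
  have dist: "(\<integral>x. (cmod (f x - (\<Sum>n\<in>J. a n * e n x)))\<^sup>2 \<partial>\<mu>)
      = S - (\<Sum>n\<in>J. (cmod (c n))\<^sup>2) + (\<Sum>n\<in>J. (cmod (c n - a n))\<^sup>2)" if "finite J" for J a
  proof -
    define t where "t x = (\<Sum>n\<in>J. a n * e n x)" for x
    have t: "t \<in> L2_space \<mu>"
      unfolding t_def by (intro L2_space_sum L2_space_scale e)
    have ft: "L2_inner \<mu> f t = (\<Sum>n\<in>J. cnj (a n) * c n)"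
    proof -
      have "L2_inner \<mu> f t = cnj (L2_inner \<mu> t f)" by (simp add: cnj_L2_inner)
      also have "L2_inner \<mu> t f = (\<Sum>n\<in>J. a n * L2_inner \<mu> (e n) f)"
        unfolding t_def by (rule L2_inner_sum_left) (auto intro: e f)
      finally show ?thesis by (simp add: cnj_L2_inner c_def)
    qed
    have "(\<integral>x. (cmod (t x))\<^sup>2 \<partial>\<mu>) = (\<Sum>n\<in>J. (cmod (a n))\<^sup>2)"
      unfolding t_def by (rule integral_orthonormal_combination[OF e on \<open>finite J\<close>])
    then have "(\<integral>x. (cmod (f x - t x))\<^sup>2 \<partial>\<mu>)
        = S - 2 * (\<Sum>n\<in>J. Re (cnj (a n) * c n)) + (\<Sum>n\<in>J. (cmod (a n))\<^sup>2)"
      using integral_norm_diff_squared[OF f t] by (simp only: ft S_def Re_sum)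
    also have "\<dots> = S - (\<Sum>n\<in>J. (cmod (c n))\<^sup>2) + (\<Sum>n\<in>J. (cmod (c n - a n))\<^sup>2)"
    proof -
      have "(\<Sum>n\<in>J. (cmod (c n - a n))\<^sup>2)
          = (\<Sum>n\<in>J. (cmod (c n))\<^sup>2 - 2 * Re (cnj (a n) * c n) + (cmod (a n))\<^sup>2)"
        by (intro sum.cong refl) (simp add: cmod_power2 power2_diff)
      then show ?thesis by (simp add: sum.distrib sum_subtractf sum_distrib_left)
    qed
    finally show ?thesis by (simp add: t_def)
  qed
  have le: "(\<Sum>n\<in>J. (cmod (c n))\<^sup>2) \<le> S" if "finite J" for J
  proof -
    have "0 \<le> (\<integral>x. (cmod (f x - (\<Sum>n\<in>J. c n * e n x)))\<^sup>2 \<partial>\<mu>)" by simp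
    then show ?thesis using dist[OF that, of c] by simp
  qed
  have "((\<lambda>n. (cmod (c n))\<^sup>2) has_sum S) UNIV"
    unfolding has_sum_def tendsto_iff eventually_finite_subsets_at_top
  proof (intro allI impI)
    fix \<epsilon> :: real assume "\<epsilon> > 0"
    from dense[OF this] obtain J a where J: "finite J"
      "(\<integral>x. (cmod (f x - (\<Sum>n\<in>J. a n * e n x)))\<^sup>2 \<partial>\<mu>) < \<epsilon>" by blast
    have "S - (\<Sum>n\<in>J. (cmod (c n))\<^sup>2) < \<epsilon>"
      using J(2) dist[OF J(1), of a] sum_nonneg[of J "\<lambda>n. (cmod (c n - a n))\<^sup>2"] by simp
    \<comment> \<open>Partial sums grow with the index set and stay below S, so the estimate for J
      persists for every finite superset.\<close>
    then have "dist (\<Sum>n\<in>Y. (cmod (c n))\<^sup>2) S < \<epsilon>" if "finite Y" "J \<subseteq> Y" for Y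
      using sum_mono2[OF that, of "\<lambda>n. (cmod (c n))\<^sup>2"] le[OF that(1)] by (simp add: dist_real_def)
    with J(1) show "\<exists>X. finite X \<and> X \<subseteq> UNIV \<and> (\<forall>Y. finite Y \<and> X \<subseteq> Y \<and> Y \<subseteq> UNIV \<longrightarrow>
        dist (\<Sum>n\<in>Y. (cmod (c n))\<^sup>2) S < \<epsilon>)"
      by (intro exI[of _ J]) simp
  qed
  then show ?thesis by (simp add: c_def S_def)
qed

section \<open>Fourier analysis on the unit cube\<close>

definition fourier :: "int^'d \<Rightarrow> real^'d \<Rightarrow> complex" where
  "fourier n x = cis (2 * pi * (real_vec n \<bullet> x))"

lemma real_vec_simps [simp]:
  "real_vec 0 = 0" "real_vec (- m) = - real_vec m"
  "real_vec (m + n) = real_vec m + real_vec n" "real_vec (m - n) = real_vec m - real_vec n"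
  by (simp_all add: real_vec_def vec_eq_iff)

lemma fourier_0 [simp]: "fourier 0 x = 1"
  by (simp add: fourier_def)

lemma norm_fourier [simp]: "cmod (fourier n x) = 1"
  by (simp add: fourier_def)

lemma cnj_fourier: "cnj (fourier n x) = fourier (- n) x"
  by (simp add: fourier_def cis_cnj inner_minus_left)

lemma fourier_mult: "fourier m x * fourier n x = fourier (m + n) x"
  by (simp add: fourier_def cis_mult inner_add_left distrib_left)

lemma fourier_real_vec [simp]: "fourier n (real_vec m) = 1"
proof -
  have "real_vec n \<bullet> real_vec m = of_int (\<Sum>i\<in>UNIV. n$i * m$i)"
    by (simp add: inner_vec_def real_vec_def)
  then show ?thesis
    unfolding fourier_def by (metis cis_multiple_2pi Ints_of_int)
qed

lemma fourier_add_real_vec: "fourier n (x + real_vec m) = fourier n x"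
proof -
  have "fourier n (x + real_vec m) = fourier n x * fourier n (real_vec m)"
    by (simp add: fourier_def cis_mult inner_add_right distrib_left)
  then show ?thesis by simp
qed

lemma continuous_cis [continuous_intros]:
  "continuous_on S f \<Longrightarrow> continuous_on S (\<lambda>x. cis (f x))"
  unfolding cis_conv_exp by (intro continuous_intros)

lemma measurable_cis [measurable]: "cis \<in> borel_measurable borel"
  by (intro borel_measurable_continuous_onI continuous_intros)

lemma borel_measurable_fourier [measurable]: "fourier n \<in> borel_measurable borel"
  unfolding fourier_def[abs_def] by (intro borel_measurable_continuous_onI continuous_intros)

section \<open>The cube \<open>Q0\<close> and orthonormality of the characters\<close>

lemma Q0_bounds: "box (- (\<chi> i. 1/2)) (\<chi> i. 1/2) \<subseteq> (Q0 :: (real^'d) set)"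
  "Q0 \<subseteq> cbox (- (\<chi> i. 1/2) :: real^'d) (\<chi> i. 1/2)"
  by (auto simp: Q0_def mem_box_cart less_imp_le)

lemma Q0_borel [measurable]: "(Q0 :: (real^'d) set) \<in> sets borel"
proof -
  have "Q0 = (\<Inter>i. {x::real^'d. - 1/2 \<le> x $ i} \<inter> {x. x $ i < 1/2})" by (auto simp: Q0_def)
  moreover have "{x::real^'d. - 1/2 \<le> x $ i} \<in> sets borel" "{x::real^'d. x $ i < 1/2} \<in> sets borel" for i
    by (auto intro!: borel_closed borel_open closed_Collect_le open_Collect_less continuous_intros)
  ultimately show ?thesis using sets.countable_INT''[of borel UNIV "\<lambda>i. {x::real^'d. - 1/2 \<le> x $ i} \<inter> {x. x $ i < 1/2}"]
    by simp
qed

lemma Q0_lebesgue [measurable]: "Q0 \<in> sets lebesgue" "Q0 \<in> sets lborel"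
  by (auto intro: sets_completionI_sets)

lemma finite_measure_Q0: "finite_measure (lebesgue_on (Q0 :: (real^'d) set))"
proof
  have "emeasure lebesgue (Q0 :: (real^'d) set) \<le> emeasure lebesgue (cbox (- (\<chi> i. 1/2) :: real^'d) (\<chi> i. 1/2))"
    using Q0_bounds(2) by (intro emeasure_mono) auto
  also have "\<dots> < top" by (simp add: emeasure_lborel_cbox_eq)
  finally show "emeasure (lebesgue_on (Q0 :: (real^'d) set)) (space (lebesgue_on Q0)) \<noteq> \<infinity>"
    by (simp add: emeasure_restrict_space)
qed

text \<open>By \<open>lborel_eq\<close>, Lebesgue-Borel measure is the image of a product of
  one-dimensional measures indexed by \<open>Basis\<close>, so Fubini's theorem for products of
  functions of one variable applies.\<close>

lemma integral_lborel_prod: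
  fixes f :: "'a::euclidean_space \<Rightarrow> real \<Rightarrow> complex"
  assumes int: "\<And>b. b \<in> Basis \<Longrightarrow> integrable lborel (f b)"
  shows "(\<integral>x. (\<Prod>b\<in>Basis. f b (x \<bullet> b)) \<partial>lborel) = (\<Prod>b\<in>Basis. integral\<^sup>L lborel (f b))"
proof -
  interpret product_sigma_finite "\<lambda>_. lborel :: real measure" ..
  have [measurable]: "f b \<in> borel_measurable borel" if "b \<in> Basis" for b
    using int[OF that] by auto
  have "(\<integral>x. (\<Prod>b\<in>Basis. f b (x \<bullet> b)) \<partial>(lborel :: 'a measure))
      = (\<integral>x. (\<Prod>b\<in>Basis. f b ((\<Sum>b\<in>Basis. x b *\<^sub>R b) \<bullet> b)) \<partial>(\<Pi>\<^sub>M b\<in>Basis. lborel))"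
    by (subst lborel_eq) (simp add: integral_distr)
  also have "\<dots> = (\<integral>x. (\<Prod>b\<in>Basis. f b (x b)) \<partial>(\<Pi>\<^sub>M b\<in>(Basis::'a set). lborel))"
    by simp
  also have "\<dots> = (\<Prod>b\<in>Basis. integral\<^sup>L lborel (f b))"
    by (rule product_integral_prod) (auto intro: int)
  finally show ?thesis .
qed

lemma integral_cis_period:
  "(\<integral>t. indicator {-1/2..<1/2} t *\<^sub>R cis (2 * pi * of_int k * t) \<partial>lborel) = (if k = 0 then 1 else 0)"
  (is "?I = _")
proof -
  \<comment> \<open>The fundamental theorem of calculus is stated for closed intervals; the added
    endpoint 1/2 is a null set.\<close>
  have "?I = (\<integral>t. indicator {-1/2..1/2} t *\<^sub>R cis (2 * pi * of_int k * t) \<partial>lborel)"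
  proof (rule integral_cong_AE)
    show "AE t in lborel. indicator {-1/2..<1/2} t *\<^sub>R cis (2 * pi * of_int k * t)
        = indicator {-1/2..1/2} t *\<^sub>R cis (2 * pi * of_int k * t)"
      using AE_lborel_singleton[of "1/2::real"] by eventually_elim (auto simp: indicator_def)
  qed measurable
  also have "\<dots> = (if k = 0 then 1 else 0)"
  proof (cases "k = 0")
    case False
    define F where "F t = cis (2 * pi * of_int k * t) / (2 * pi * \<i> * of_int k)" for t
    have "(\<integral>t. indicator {-1/2..1/2} t *\<^sub>R cis (2 * pi * of_int k * t) \<partial>lborel) = F (1/2) - F (-1/2)"
    proof (rule integral_FTC_Icc)
      fix t :: real
      show "(F has_vector_derivative cis (2 * pi * of_int k * t)) (at t within {-1/2..1/2})"
        unfolding F_def cis_conv_exp using False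
        by (auto intro!: derivative_eq_intros has_vector_derivative_real_field simp: field_simps)
    qed (auto intro!: continuous_intros)
    \<comment> \<open>The arguments at the two endpoints are pi k and -pi k; they differ by k full
      turns.\<close>
    also have "F (1/2) = F (-1/2)"
    proof -
      have "cis (pi * of_int k) = cis (2 * pi * of_int k) * cis (- (pi * of_int k))"
        by (simp only: cis_mult) simp
      then show ?thesis by (simp add: F_def cis_multiple_2pi)
    qed
    finally show ?thesis using False by simp
  qed simp
  finally show ?thesis .
qed

text \<open>Both the character and the indicator of the cube factor over the coordinates, which
  reduces the integral to \<open>integral_cis_period\<close>. A single nonzero coordinate of n makes
  the product vanish.\<close>

lemma integral_fourier:
  fixes n :: "int^'d"
  shows "(\<integral>x. fourier n x \<partial>lebesgue_on Q0) = (if n = 0 then 1 else 0)"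
proof -
  define f :: "real^'d \<Rightarrow> real \<Rightarrow> complex" where
    "f b t = indicator {-1/2..<1/2} t *\<^sub>R cis (2 * pi * (real_vec n \<bullet> b) * t)" for b t
  have int: "integrable lborel (f b)" for b
  proof -
    have [measurable]: "f b \<in> borel_measurable borel"
      unfolding f_def[abs_def] by measurable
    have "integrable lborel (\<lambda>t. indicator {-1/2..<1/2::real} t :: real)" by auto
    then show ?thesis
      by (rule Bochner_Integration.integrable_bound) (auto simp: f_def indicator_def)
  qed
  have Q0_iff: "x \<in> Q0 \<longleftrightarrow> (\<forall>b\<in>Basis. x \<bullet> b \<in> {-1/2..<1/2})" for x :: "real^'d"
    by (auto simp: Q0_def Basis_vec_def inner_axis)
  \<comment> \<open>The integrand is Borel measurable, so the integral for the completed measure is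
    the one for \<open>lborel\<close>, where the product structure is available.\<close>
  have "(\<integral>x. fourier n x \<partial>lebesgue_on Q0) = (\<integral>x. indicator Q0 x *\<^sub>R fourier n x \<partial>lborel)"
    by (subst integral_restrict_space) (auto intro!: integral_completion)
  also have "\<dots> = (\<integral>x. (\<Prod>b\<in>Basis. f b (x \<bullet> b)) \<partial>lborel)"
  proof (rule Bochner_Integration.integral_cong[OF refl])
    fix x :: "real^'d"
    show "indicator Q0 x *\<^sub>R fourier n x = (\<Prod>b\<in>Basis. f b (x \<bullet> b))"
    proof (cases "x \<in> Q0")
      case True
      have "cis (sum g B) = (\<Prod>b\<in>B. cis (g b))" for g :: "real^'d \<Rightarrow> real" and B
        by (induction B rule: infinite_finite_induct) (auto simp: cis_mult[symmetric])
      then have "fourier n x = (\<Prod>b\<in>Basis. cis (2 * pi * (real_vec n \<bullet> b) * (x \<bullet> b)))"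
        unfolding fourier_def
        by (subst euclidean_inner) (simp add: sum_distrib_left mult.assoc)
      with True show ?thesis by (auto simp: f_def Q0_iff intro!: prod.cong)
    next
      case False
      then obtain b where "b \<in> Basis" "x \<bullet> b \<notin> {-1/2..<1/2}" by (auto simp: Q0_iff)
      then show ?thesis using False by (auto intro!: bexI[of _ b] simp: f_def prod_zero_iff)
    qed
  qed
  also have "\<dots> = (\<Prod>b\<in>Basis. integral\<^sup>L lborel (f b))"
    by (rule integral_lborel_prod) (rule int)
  also have "\<dots> = (\<Prod>b\<in>(Basis::(real^'d) set). if real_vec n \<bullet> b = 0 then 1 else 0)"
  proof (rule prod.cong[OF refl])
    fix b :: "real^'d" assume "b \<in> Basis"
    then obtain i where "b = axis i 1" by (auto simp: Basis_vec_def)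
    then have "real_vec n \<bullet> b = of_int (n $ i)" by (simp add: inner_axis real_vec_def)
    then show "integral\<^sup>L lborel (f b) = (if real_vec n \<bullet> b = 0 then 1 else 0)"
      using integral_cis_period[of "n $ i"] by (simp add: f_def[abs_def])
  qed
  also have "\<dots> = (if n = 0 then 1 else 0)"
  proof -
    have "(\<forall>b\<in>Basis. real_vec n \<bullet> b = 0) \<longleftrightarrow> n = 0"
      by (simp only: euclidean_all_zero_iff) (simp add: real_vec_def vec_eq_iff)
    then show ?thesis by (cases "n = 0") (auto simp: prod_zero_iff)
  qed
  finally show ?thesis .
qed

lemma measurable_fourier_Q0 [measurable]: "fourier n \<in> borel_measurable (lebesgue_on Q0)"
  by (intro measurable_restrict_space1 measurable_completion) simp

lemma fourier_L2: "fourier n \<in> L2_space (lebesgue_on Q0)"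
  by (rule L2_space_bounded[OF finite_measure_Q0, of _ 1]) auto

lemma fourier_orthonormal:
  "L2_inner (lebesgue_on Q0) (fourier m) (fourier n) = (if m = n then 1 else 0)"
  using integral_fourier[of "m - n"] by (simp add: L2_inner_def cnj_fourier fourier_mult)

section \<open>Trigonometric polynomials\<close>

inductive trig_poly :: "(real^'d \<Rightarrow> complex) \<Rightarrow> bool" where
  monomial: "trig_poly (\<lambda>x. c * fourier n x)"
| add: "trig_poly f \<Longrightarrow> trig_poly g \<Longrightarrow> trig_poly (\<lambda>x. f x + g x)"

lemma trig_poly_const: "trig_poly (\<lambda>x. c)"
  using trig_poly.monomial[of c 0] by simp

lemma trig_poly_monomial_mult:
  assumes "trig_poly f"
  shows "trig_poly (\<lambda>x. c * fourier m x * f x)"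
  using assms
proof induction
  case (monomial d n)
  have "(\<lambda>x. c * fourier m x * (d * fourier n x)) = (\<lambda>x. (c * d) * fourier (m + n) x)"
    by (simp add: fourier_mult[symmetric] mult_ac)
  then show ?case by (simp only: trig_poly.monomial)
qed (simp add: distrib_left trig_poly.add)

lemma trig_poly_mult:
  assumes "trig_poly f" "trig_poly g"
  shows "trig_poly (\<lambda>x. f x * g x)"
  using assms(1)
proof induction
  case (monomial c n)
  show ?case by (rule trig_poly_monomial_mult) fact
qed (simp add: distrib_right trig_poly.add)

lemma trig_poly_sum:
  "(\<And>i. i \<in> I \<Longrightarrow> trig_poly (f i)) \<Longrightarrow> trig_poly (\<lambda>x. \<Sum>i\<in>I. f i x)"
  by (induction I rule: infinite_finite_induct) (auto simp: trig_poly_const trig_poly.add)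

text \<open>The inductive form suits the closure under sums and products; the finite sum recovered
  here is the form in which \<open>parseval_of_dense\<close> asks for approximants.\<close>

lemma trig_poly_expansion:
  assumes "trig_poly f"
  obtains J a where "finite J" "f = (\<lambda>x. \<Sum>n\<in>J. a n * fourier n x)"
proof -
  from assms have "\<exists>J a. finite J \<and> f = (\<lambda>x. \<Sum>n\<in>J. a n * fourier n x)"
  proof induction
    case (monomial c n)
    then show ?case by (intro exI[of _ "{n}"] exI[of _ "\<lambda>_. c"]) auto
  next
    case (add f g)
    then obtain J a K b where fin: "finite J" "finite K"
      and fg: "f = (\<lambda>x. \<Sum>n\<in>J. a n * fourier n x)" "g = (\<lambda>x. \<Sum>n\<in>K. b n * fourier n x)"
      by auto
    \<comment> \<open>Two sums over different frequency sets are brought to the common index set by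
      padding the coefficients with zeros.\<close>
    have ext: "(\<Sum>n\<in>A. c n * fourier n x) = (\<Sum>n\<in>J \<union> K. (if n \<in> A then c n else 0) * fourier n x)"
      if "A \<subseteq> J \<union> K" for A c x
      using fin that by (intro sum.mono_neutral_cong_left) auto
    have "(\<lambda>x. f x + g x) = (\<lambda>x. \<Sum>n\<in>J \<union> K.
        ((if n \<in> J then a n else 0) + (if n \<in> K then b n else 0)) * fourier n x)"
      unfolding fg distrib_right sum.distrib
      by (simp add: ext[of J] ext[of K])
    then show ?case
      using fin by (intro exI[of _ "J \<union> K"] exI[of _ "\<lambda>n. (if n \<in> J then a n else 0) + (if n \<in> K then b n else 0)"]) simp
  qed
  then show thesis using that by blast
qed

lemma trig_poly_L2: "trig_poly f \<Longrightarrow> f \<in> L2_space (lebesgue_on Q0)"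
  by (induction rule: trig_poly.induct) (auto intro: L2_space_scale L2_space_add fourier_L2)

section \<open>The torus in complex space and pullbacks of polynomials\<close>

definition torus_map :: "real^'d \<Rightarrow> complex^'d" where
  "torus_map x = (\<chi> i. cis (2 * pi * x $ i))"

lemma continuous_torus_map: "continuous_on S torus_map"
  unfolding torus_map_def[abs_def] by (intro continuous_intros)

lemma torus_map_fourier: "torus_map x $ i = fourier (axis i 1) x"
proof -
  have "real_vec (axis i 1) = axis i 1" by (simp add: real_vec_def axis_def vec_eq_iff)
  then show ?thesis
    by (simp add: torus_map_def fourier_def inner_axis')
qed

text \<open>Equal images differ by an integer in each coordinate. Only one point may lie on the
  boundary: with x strictly inside, the difference lies strictly between -1 and 1, whereas opposite
  faces have the same image.\<close>

lemma torus_map_cube_inj: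
  assumes x: "x \<in> box (- (\<chi> i. 1/2)) (\<chi> i. 1/2)" and y: "y \<in> cbox (- (\<chi> i. 1/2)) (\<chi> i. 1/2)"
    and eq: "torus_map x = torus_map y"
  shows "x = y"
proof -
  have "x $ i = y $ i" for i
  proof -
    have "cis (2 * pi * x $ i) = cis (2 * pi * y $ i)"
      using eq by (simp add: torus_map_def vec_eq_iff)
    then have "sin (2 * pi * x $ i) = sin (2 * pi * y $ i) \<and> cos (2 * pi * x $ i) = cos (2 * pi * y $ i)"
      by (simp add: complex_eq_iff)
    then obtain n :: int where "2 * pi * x $ i = 2 * pi * y $ i + 2 * pi * n"
      unfolding sin_cos_eq_iff by auto
    then have n: "x $ i = y $ i + n" by (simp flip: distrib_left)
    moreover have "- 1/2 < x $ i" "x $ i < 1/2" "- 1/2 \<le> y $ i" "y $ i \<le> 1/2"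
      using x y by (auto simp: mem_box_cart)
    ultimately have "-1 < real_of_int n" "real_of_int n < 1" by auto
    then have "n = 0" by linarith
    with n show ?thesis by simp
  qed
  then show ?thesis by (simp add: vec_eq_iff)
qed

text \<open>Real and imaginary part of a coordinate on the torus are combinations of a character and
  its conjugate; sums and products preserve trigonometric polynomials.\<close>

lemma trig_poly_real_polynomial:
  assumes "real_polynomial_function g"
  shows "trig_poly (\<lambda>x. complex_of_real (g (torus_map x)))"
  using assms
proof induction
  case (linear f)
  then interpret f: bounded_linear f .
  \<comment> \<open>The generator of a real polynomial function is an arbitrary real-linear
    functional. It is expanded in the real basis formed by the unit vectors and their multiples by
    the imaginary unit.\<close>
  have coord: "f z = (\<Sum>i\<in>UNIV. Re (z $ i) * f (axis i 1) + Im (z $ i) * f (axis i \<i>))" for z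
  proof -
    have "z = (\<Sum>i\<in>UNIV. Re (z $ i) *\<^sub>R axis i 1 + Im (z $ i) *\<^sub>R axis i \<i>)"
    proof (subst vec_eq_iff, intro allI)
      fix i
      have "(\<Sum>j\<in>UNIV. Re (z $ j) *\<^sub>R axis j 1 + Im (z $ j) *\<^sub>R axis j \<i>) $ i
          = (\<Sum>j\<in>UNIV. if j = i then z $ i else 0)"
        by (simp only: sum_component) (rule sum.cong, auto simp: axis_def complex_eq_iff)
      then show "z $ i = (\<Sum>j\<in>UNIV. Re (z $ j) *\<^sub>R axis j 1 + Im (z $ j) *\<^sub>R axis j \<i>) $ i"
        by simp
    qed
    then have "f z = f (\<Sum>i\<in>UNIV. Re (z $ i) *\<^sub>R axis i 1 + Im (z $ i) *\<^sub>R axis i \<i>)" by simp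
    then show ?thesis by (simp add: f.sum f.add f.scaleR)
  qed
  have ReIm: "complex_of_real (Re w) = (w + cnj w) / 2" "complex_of_real (Im w) = (w - cnj w) / (2 * \<i>)" for w
    by (auto simp: complex_eq_iff)
  have *: "trig_poly (\<lambda>x. complex_of_real (Re (torus_map x $ i)) * of_real a)"
          "trig_poly (\<lambda>x. complex_of_real (Im (torus_map x $ i)) * of_real a)" for i a
  proof -
    have "complex_of_real (Re (torus_map x $ i)) * of_real a
        = (a / 2) * fourier (axis i 1) x + (a / 2) * fourier (- axis i 1) x"
      "complex_of_real (Im (torus_map x $ i)) * of_real a
        = (a / (2 * \<i>)) * fourier (axis i 1) x + (- a / (2 * \<i>)) * fourier (- axis i 1) x" for x
      by (simp_all add: ReIm torus_map_fourier cnj_fourier field_simps)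
    then show "trig_poly (\<lambda>x. complex_of_real (Re (torus_map x $ i)) * of_real a)"
          "trig_poly (\<lambda>x. complex_of_real (Im (torus_map x $ i)) * of_real a)"
      by (simp_all only: trig_poly.intros)
  qed
  show ?case
    by (subst coord) (simp only: of_real_sum of_real_add of_real_mult, intro trig_poly_sum trig_poly.add *)
next
  case (const c)
  show ?case by (rule trig_poly_const)
next
  case (add f g)
  then show ?case by (simp add: trig_poly.add)
next
  case (mult f g)
  then show ?case by (simp add: trig_poly_mult)
qed

section \<open>The closure of the trigonometric polynomials in L^2, with distances squared\<close>

definition trig_closure :: "(real^'d \<Rightarrow> complex) \<Rightarrow> bool" where
  "trig_closure f \<longleftrightarrow> f \<in> L2_space (lebesgue_on Q0) \<and>
     (\<forall>\<epsilon>>0. \<exists>t. trig_poly t \<and> (\<integral>x. (cmod (f x - t x))\<^sup>2 \<partial>lebesgue_on Q0) < \<epsilon>)"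

text \<open>A triangle inequality for squared distances. Its two factors 2 are the reason for the
  approximation by a quarter of the tolerance in the closure lemmas.\<close>

lemma integral_norm_add_squared_le:
  assumes "f \<in> L2_space \<mu>" "g \<in> L2_space \<mu>"
  shows "(\<integral>x. (cmod (f x + g x))\<^sup>2 \<partial>\<mu>)
    \<le> 2 * (\<integral>x. (cmod (f x))\<^sup>2 \<partial>\<mu>) + 2 * (\<integral>x. (cmod (g x))\<^sup>2 \<partial>\<mu>)"
proof -
  have "(\<integral>x. (cmod (f x + g x))\<^sup>2 \<partial>\<mu>) \<le> (\<integral>x. 2 * (cmod (f x))\<^sup>2 + 2 * (cmod (g x))\<^sup>2 \<partial>\<mu>)"
    using assms L2_space_add[OF assms] cmod_add_squared_le
    by (intro integral_mono) (auto simp: L2_space_iff)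
  also have "\<dots> = 2 * (\<integral>x. (cmod (f x))\<^sup>2 \<partial>\<mu>) + 2 * (\<integral>x. (cmod (g x))\<^sup>2 \<partial>\<mu>)"
    using assms by (subst Bochner_Integration.integral_add) (auto simp: L2_space_iff)
  finally show ?thesis .
qed

lemma trig_closure_closed:
  assumes f: "f \<in> L2_space (lebesgue_on Q0)"
    and approx: "\<And>\<epsilon>. \<epsilon> > 0 \<Longrightarrow> \<exists>g. trig_closure g \<and> (\<integral>x. (cmod (f x - g x))\<^sup>2 \<partial>lebesgue_on Q0) < \<epsilon>"
  shows "trig_closure f"
  unfolding trig_closure_def
proof (intro conjI allI impI f)
  fix \<epsilon> :: real assume "\<epsilon> > 0"
  then obtain g where g: "trig_closure g" "(\<integral>x. (cmod (f x - g x))\<^sup>2 \<partial>lebesgue_on Q0) < \<epsilon> / 4"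
    using approx[of "\<epsilon> / 4"] by auto
  then obtain t where t: "trig_poly t" "(\<integral>x. (cmod (g x - t x))\<^sup>2 \<partial>lebesgue_on Q0) < \<epsilon> / 4"
    using \<open>\<epsilon> > 0\<close> by (auto simp: trig_closure_def dest: spec[of _ "\<epsilon> / 4"])
  have gL: "g \<in> L2_space (lebesgue_on Q0)" using g(1) by (simp add: trig_closure_def)
  have "(\<integral>x. (cmod ((f x - g x) + (g x - t x)))\<^sup>2 \<partial>lebesgue_on Q0) < \<epsilon>"
    using integral_norm_add_squared_le[OF L2_space_diff[OF f gL] L2_space_diff[OF gL trig_poly_L2[OF t(1)]]]
      g(2) t(2) by simp
  with t(1) show "\<exists>t. trig_poly t \<and> (\<integral>x. (cmod (f x - t x))\<^sup>2 \<partial>lebesgue_on Q0) < \<epsilon>" by auto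
qed

lemma trig_closure_poly: "trig_poly t \<Longrightarrow> trig_closure t"
  by (auto simp: trig_closure_def intro: trig_poly_L2 exI[of _ t])

lemma trig_closure_add:
  assumes f: "trig_closure f" and g: "trig_closure g"
  shows "trig_closure (\<lambda>x. f x + g x)"
  unfolding trig_closure_def
proof (intro conjI allI impI)
  have L: "f \<in> L2_space (lebesgue_on Q0)" "g \<in> L2_space (lebesgue_on Q0)"
    using f g by (auto simp: trig_closure_def)
  then show "(\<lambda>x. f x + g x) \<in> L2_space (lebesgue_on Q0)" by (rule L2_space_add)
  fix \<epsilon> :: real assume "\<epsilon> > 0"
  then obtain s t where s: "trig_poly s" "(\<integral>x. (cmod (f x - s x))\<^sup>2 \<partial>lebesgue_on Q0) < \<epsilon> / 4"
    and t: "trig_poly t" "(\<integral>x. (cmod (g x - t x))\<^sup>2 \<partial>lebesgue_on Q0) < \<epsilon> / 4"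
    using f g unfolding trig_closure_def by (meson divide_pos_pos zero_less_numeral)
  have "(\<integral>x. (cmod ((f x - s x) + (g x - t x)))\<^sup>2 \<partial>lebesgue_on Q0) < \<epsilon>"
    using integral_norm_add_squared_le[OF L2_space_diff[OF L(1) trig_poly_L2[OF s(1)]]
        L2_space_diff[OF L(2) trig_poly_L2[OF t(1)]]] s(2) t(2) by simp
  then show "\<exists>t. trig_poly t \<and> (\<integral>x. (cmod (f x + g x - t x))\<^sup>2 \<partial>lebesgue_on Q0) < \<epsilon>"
    by (intro exI[of _ "\<lambda>x. s x + t x"]) (simp add: trig_poly.add s t algebra_simps)
qed

lemma trig_closure_scale:
  assumes f: "trig_closure f"
  shows "trig_closure (\<lambda>x. c * f x)"
proof (cases "c = 0")
  case True
  then show ?thesis using trig_closure_poly[OF trig_poly_const] by simp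
next
  case False
  show ?thesis
    unfolding trig_closure_def
  proof (intro conjI allI impI)
    show "(\<lambda>x. c * f x) \<in> L2_space (lebesgue_on Q0)"
      using f by (auto simp: trig_closure_def intro: L2_space_scale)
    fix \<epsilon> :: real assume "\<epsilon> > 0"
    then have "0 < \<epsilon> / (cmod c)\<^sup>2" using False by simp
    then obtain t where t: "trig_poly t" "(\<integral>x. (cmod (f x - t x))\<^sup>2 \<partial>lebesgue_on Q0) < \<epsilon> / (cmod c)\<^sup>2"
      using f unfolding trig_closure_def by blast
    have "(cmod (c * f x - c * t x))\<^sup>2 = (cmod c)\<^sup>2 * (cmod (f x - t x))\<^sup>2" for x
      by (simp add: norm_mult power_mult_distrib flip: right_diff_distrib)
    then have "(\<integral>x. (cmod (c * f x - c * t x))\<^sup>2 \<partial>lebesgue_on Q0) < \<epsilon>"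
      using t(2) False by (simp add: field_simps)
    moreover have "trig_poly (\<lambda>x. c * t x)" by (rule trig_poly_mult[OF trig_poly_const t(1)])
    ultimately show "\<exists>t. trig_poly t \<and> (\<integral>x. (cmod (c * f x - t x))\<^sup>2 \<partial>lebesgue_on Q0) < \<epsilon>" by blast
  qed
qed

text \<open>Dominated convergence: the common majorant w gives |f - g k| <= 2 w, hence the bound 4
  w^2 for the squares, and pointwise convergence becomes convergence in L^2. Each extension of the
  class of approximable functions by pointwise limits goes through this lemma.\<close>

lemma trig_closure_limit:
  assumes g: "\<And>k::nat. trig_closure (g k)"
    and f: "f \<in> borel_measurable (lebesgue_on Q0)"
    and lim: "AE x in lebesgue_on Q0. (\<lambda>k. g k x) \<longlonglongrightarrow> f x"
    and bound: "\<And>k x. x \<in> Q0 \<Longrightarrow> cmod (g k x) \<le> w x" "\<And>x. x \<in> Q0 \<Longrightarrow> cmod (f x) \<le> w x"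
    and w: "integrable (lebesgue_on Q0) (\<lambda>x. (w x)\<^sup>2)"
  shows "trig_closure f"
proof (rule trig_closure_closed)
  have gL: "g k \<in> L2_space (lebesgue_on Q0)" for k using g by (simp add: trig_closure_def)
  have [measurable]: "g k \<in> borel_measurable (lebesgue_on Q0)" for k
    using gL by (simp add: L2_space_iff)
  note [measurable] = f
  show fL: "f \<in> L2_space (lebesgue_on Q0)"
    unfolding L2_space_iff
  proof
    show "integrable (lebesgue_on Q0) (\<lambda>x. (cmod (f x))\<^sup>2)"
      by (rule Bochner_Integration.integrable_bound[OF w])
        (use bound(2) in \<open>auto intro!: AE_I2 power_mono\<close>)
  qed (rule f)
  fix \<epsilon> :: real assume "\<epsilon> > 0"
  have "(\<lambda>k. \<integral>x. (cmod (f x - g k x))\<^sup>2 \<partial>lebesgue_on Q0) \<longlonglongrightarrow> (\<integral>x. 0 \<partial>lebesgue_on (Q0::(real^'a) set))"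
  proof (rule integral_dominated_convergence)
    show "integrable (lebesgue_on Q0) (\<lambda>x. 4 * (w x)\<^sup>2)" using w by simp
    show "AE x in lebesgue_on Q0. (\<lambda>k. (cmod (f x - g k x))\<^sup>2) \<longlonglongrightarrow> 0"
      using lim
    proof eventually_elim
      case (elim x)
      then have "(\<lambda>k. (cmod (f x - g k x))\<^sup>2) \<longlonglongrightarrow> (cmod (f x - f x))\<^sup>2"
        by (intro tendsto_intros)
      then show ?case by simp
    qed
    show "AE x in lebesgue_on Q0. norm ((cmod (f x - g k x))\<^sup>2) \<le> 4 * (w x)\<^sup>2" for k
    proof (rule AE_I2)
      fix x :: "real^'a" assume "x \<in> space (lebesgue_on Q0)"
      then have "cmod (f x - g k x) \<le> 2 * w x"
        using bound(1)[of x k] bound(2)[of x] norm_triangle_ineq4[of "f x" "g k x"] by auto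
      then have "(cmod (f x - g k x))\<^sup>2 \<le> (2 * w x)\<^sup>2" by (intro power_mono) auto
      then show "norm ((cmod (f x - g k x))\<^sup>2) \<le> 4 * (w x)\<^sup>2" by (simp add: power_mult_distrib)
    qed
  qed measurable
  then have "eventually (\<lambda>k. (\<integral>x. (cmod (f x - g k x))\<^sup>2 \<partial>lebesgue_on Q0) < \<epsilon>) sequentially"
    using \<open>\<epsilon> > 0\<close> by (intro order_tendstoD(2)) auto
  then show "\<exists>g. trig_closure g \<and> (\<integral>x. (cmod (f x - g x))\<^sup>2 \<partial>lebesgue_on Q0) < \<epsilon>"
    using g by (auto simp: eventually_sequentially)
qed

text \<open>Stone-Weierstrass on the compact image \<open>C\<close> of the closed cube gives
  polynomials within 1 / (k + 1) of h. As these errors are at most 1, the constant B + 1 dominates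
  the whole sequence, and \<open>Q0\<close> has finite measure.\<close>

lemma trig_closure_continuous:
  fixes h :: "complex^'d \<Rightarrow> real"
  assumes cont: "continuous_on UNIV h"
  shows "trig_closure (\<lambda>x. complex_of_real (h (torus_map x)))"
proof -
  define C where "C = torus_map ` cbox (- (\<chi> i. 1/2) :: real^'d) (\<chi> i. 1/2)"
  have C: "compact C"
    unfolding C_def by (intro compact_continuous_image continuous_torus_map compact_cbox)
  have h: "continuous_on C h" using cont continuous_on_subset by blast
  have "\<exists>p. real_polynomial_function p \<and> (\<forall>z\<in>C. \<bar>h z - p z\<bar> < 1 / Suc k)" for k
  proof -
    have "0 < 1 / real (Suc k)" by simp
    from Stone_Weierstrass_real_polynomial_function[OF C h this] show ?thesis by metis
  qed
  then obtain p where p: "\<And>k. real_polynomial_function (p k)"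
    "\<And>k z. z \<in> C \<Longrightarrow> \<bar>h z - p k z\<bar> < 1 / Suc k" by metis
  have in_C: "torus_map x \<in> C" if "x \<in> Q0" for x
    using that Q0_bounds(2) by (auto simp: C_def)
  obtain B where B: "\<And>z. z \<in> C \<Longrightarrow> \<bar>h z\<bar> \<le> B"
    using compact_imp_bounded[OF compact_continuous_image[OF h C]] by (auto simp: bounded_iff)
  show ?thesis
  proof (rule trig_closure_limit)
    show "trig_closure (\<lambda>x. complex_of_real (p k (torus_map x)))" for k
      by (intro trig_closure_poly trig_poly_real_polynomial p)
    have "continuous_on UNIV (\<lambda>x. complex_of_real (h (torus_map x)))"
      by (intro continuous_intros continuous_on_compose2[OF cont] continuous_torus_map) auto
    then have "(\<lambda>x. complex_of_real (h (torus_map x))) \<in> borel_measurable borel"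
      by (rule borel_measurable_continuous_onI)
    then show "(\<lambda>x. complex_of_real (h (torus_map x))) \<in> borel_measurable (lebesgue_on Q0)"
      by (intro measurable_restrict_space1 measurable_completion) simp
    show "AE x in lebesgue_on Q0. (\<lambda>k. complex_of_real (p k (torus_map x))) \<longlonglongrightarrow> complex_of_real (h (torus_map x))"
    proof (rule AE_I2)
      fix x :: "real^'d" assume "x \<in> space (lebesgue_on Q0)"
      then have "torus_map x \<in> C" using in_C by simp
      then have "dist (p k (torus_map x)) (h (torus_map x)) \<le> 1 / Suc k" for k
        using p(2)[of "torus_map x" k] by (simp add: dist_real_def)
      then have "(\<lambda>k. p k (torus_map x)) \<longlonglongrightarrow> h (torus_map x)"
        by (intro metric_tendsto_imp_tendsto[OF LIMSEQ_inverse_real_of_nat]) (simp add: inverse_eq_divide)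
      then show "(\<lambda>k. complex_of_real (p k (torus_map x))) \<longlonglongrightarrow> complex_of_real (h (torus_map x))"
        by (rule tendsto_of_real)
    qed
    show "cmod (complex_of_real (p k (torus_map x))) \<le> B + 1" if "x \<in> Q0" for k x
    proof -
      have "1 / real (Suc k) \<le> 1" by simp
      then show ?thesis
        using B[OF in_C[OF that]] p(2)[OF in_C[OF that], of k] unfolding norm_of_real by linarith
    qed
    show "cmod (complex_of_real (h (torus_map x))) \<le> B + 1" if "x \<in> Q0" for x
      using B[OF in_C[OF that]] by simp
    show "integrable (lebesgue_on Q0) (\<lambda>x. (B + 1)\<^sup>2)"
      by (rule finite_measure.integrable_const[OF finite_measure_Q0])
  qed
qed

lemma AE_Q0_interior: "AE x in lebesgue_on (Q0 :: (real^'d) set). x \<in> box (- (\<chi> i. 1/2)) (\<chi> i. 1/2)"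
proof -
  let ?a = "- (\<chi> i. 1/2) :: real^'d" and ?b = "(\<chi> i. 1/2) :: real^'d"
  have "negligible (cbox ?a ?b - box ?a ?b)" by (rule negligible_frontier_interval)
  then have "cbox ?a ?b - box ?a ?b \<in> null_sets lebesgue" by (simp add: negligible_iff_null_sets)
  then have "AE x in lebesgue. x \<notin> cbox ?a ?b - box ?a ?b" by (rule AE_not_in)
  then show ?thesis
    using Q0_bounds(2) by (subst AE_restrict_space_iff) auto
qed

text \<open>The complement of \<open>U\<close> in the cube has compact image on the torus, and the continuous functions
  \<open>z \<mapsto> min 1 (k * infdist z K)\<close> increase to the indicator of the complement of that image.\<close>

lemma trig_closure_indicator_open:
  fixes U :: "(real^'d) set"
  assumes "open U"
  shows "trig_closure (\<lambda>x. indicator U x)"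
proof -
  let ?a = "- (\<chi> i. 1/2) :: real^'d" and ?b = "(\<chi> i. 1/2) :: real^'d"
  \<comment> \<open>The set is cut down to the open cube because \<open>torus_map\<close> is
    injective there even against boundary points, so no point of V shares its image with a point
    outside V.\<close>
  define V where "V = U \<inter> box ?a ?b"
  define K where "K = torus_map ` (cbox ?a ?b - V)"
  have "open V" unfolding V_def using assms by (intro open_Int open_box)
  \<comment> \<open>A corner of the cube keeps K nonempty; \<open>infdist\<close> to the empty set
    is 0, and the functions h would then vanish identically.\<close>
  have "?b \<in> cbox ?a ?b - V" by (auto simp: V_def mem_box_cart)
  then have "K \<noteq> {}" by (auto simp: K_def)
  have "compact K"
    unfolding K_def by (intro compact_continuous_image continuous_torus_map compact_diff compact_cbox \<open>open V\<close>)
  then have "closed K" by (rule compact_imp_closed)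
  have notin: "torus_map x \<notin> K" if "x \<in> V" for x
    using that torus_map_cube_inj[of x] by (auto simp: K_def V_def)
  define h where "h k z = min 1 (real k * infdist z K)" for k z
  have V: "trig_closure (\<lambda>x. indicator V x)"
  proof (rule trig_closure_limit)
    show "trig_closure (\<lambda>x. complex_of_real (h k (torus_map x)))" for k
      unfolding h_def by (intro trig_closure_continuous continuous_intros)
    have "V \<in> sets lebesgue" using \<open>open V\<close> by (simp add: sets_completionI_sets)
    then show "indicator V \<in> borel_measurable (lebesgue_on Q0)"
      by (intro measurable_restrict_space1 borel_measurable_indicator)
    show "AE x in lebesgue_on Q0. (\<lambda>k. complex_of_real (h k (torus_map x))) \<longlonglongrightarrow> indicator V x"
    proof (rule AE_I2)
      fix x :: "real^'d" assume "x \<in> space (lebesgue_on Q0)"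
      then have x: "x \<in> cbox ?a ?b" using Q0_bounds(2) by auto
      show "(\<lambda>k. complex_of_real (h k (torus_map x))) \<longlonglongrightarrow> indicator V x"
      proof (cases "x \<in> V")
        case True
        then have pos: "infdist (torus_map x) K > 0"
          using notin \<open>closed K\<close> \<open>K \<noteq> {}\<close> infdist_pos_not_in_closed by blast
        then obtain N where "1 / infdist (torus_map x) K \<le> real N" using real_arch_simple by blast
        then have "h k (torus_map x) = 1" if "k \<ge> N" for k
        proof -
          have "1 / infdist (torus_map x) K \<le> real k"
            using \<open>1 / infdist (torus_map x) K \<le> real N\<close> that by linarith
          then show ?thesis using pos by (simp add: h_def min_def field_simps)
        qed
        then have "eventually (\<lambda>k. complex_of_real (h k (torus_map x)) = 1) sequentially"
          by (auto simp: eventually_sequentially)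
        then show ?thesis using True by (simp add: tendsto_eventually)
      next
        case False
        then have "torus_map x \<in> K" using x by (auto simp: K_def)
        then show ?thesis using False by (simp add: h_def)
      qed
    qed
    show "cmod (complex_of_real (h k (torus_map x))) \<le> 1" for k x
      by (simp add: h_def infdist_nonneg)
    show "integrable (lebesgue_on Q0) (\<lambda>x. 1\<^sup>2 :: real)"
      by (rule finite_measure.integrable_const[OF finite_measure_Q0])
  qed (auto simp: indicator_def)
  \<comment> \<open>U and V differ on \<open>Q0\<close> only on the boundary of the cube, a null
    set, so the constant sequence of indicators of V converges almost everywhere to that of
    U.\<close>
  show ?thesis
  proof (rule trig_closure_limit)
    show "trig_closure (\<lambda>x. indicator V x)" by (rule V)
    have "U \<in> sets lebesgue" using \<open>open U\<close> by (simp add: sets_completionI_sets)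
    then show "indicator U \<in> borel_measurable (lebesgue_on Q0)"
      by (intro measurable_restrict_space1 borel_measurable_indicator)
    show "AE x in lebesgue_on Q0. (\<lambda>k::nat. indicator V x :: complex) \<longlonglongrightarrow> indicator U x"
      using AE_Q0_interior by eventually_elim (auto simp: V_def indicator_def)
    show "integrable (lebesgue_on Q0) (\<lambda>x. 1\<^sup>2 :: real)"
      by (rule finite_measure.integrable_const[OF finite_measure_Q0])
  qed (auto simp: indicator_def)
qed

text \<open>Outer regularity: the squared distance between the indicators of A and of an open
  superset U is the measure of the part of U - A in the cube.\<close>

lemma trig_closure_indicator:
  fixes A :: "(real^'d) set"
  assumes A: "A \<in> sets lebesgue"
  shows "trig_closure (\<lambda>x. indicator A x)"
proof (rule trig_closure_closed)
  show "(\<lambda>x. indicator A x :: complex) \<in> L2_space (lebesgue_on Q0)"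
    using A by (intro L2_space_bounded[OF finite_measure_Q0, of _ 1] measurable_restrict_space1
        borel_measurable_indicator) (auto simp: indicator_def)
  fix \<epsilon> :: real assume "\<epsilon> > 0"
  obtain U where U: "open U" "A \<subseteq> U" "U - A \<in> lmeasurable" "emeasure lebesgue (U - A) < ennreal \<epsilon>"
    using sets_lebesgue_outer_open[OF A \<open>\<epsilon> > 0\<close>] by blast
  have "(\<integral>x. (cmod (indicator A x - indicator U x))\<^sup>2 \<partial>lebesgue_on Q0)
      = (\<integral>x. indicator (U - A) x \<partial>lebesgue_on Q0)"
    using U(2) by (intro Bochner_Integration.integral_cong) (auto simp: indicator_def)
  also have "\<dots> = measure lebesgue ((U - A) \<inter> Q0)"
  proof -
    have "U - A \<in> sets lebesgue" using U(3) by (auto dest: fmeasurableD)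
    then show ?thesis by (simp add: measure_restrict_space Int_commute)
  qed
  also have "\<dots> \<le> measure lebesgue (U - A)"
    using U(3) by (intro measure_mono_fmeasurable) (auto dest: fmeasurableD)
  also have "\<dots> < \<epsilon>"
    using U(3,4) \<open>\<epsilon> > 0\<close> by (simp add: emeasure_eq_measure2 ennreal_less_iff)
  finally show "\<exists>g. trig_closure g \<and> (\<integral>x. (cmod (indicator A x - g x))\<^sup>2 \<partial>lebesgue_on Q0) < \<epsilon>"
    using trig_closure_indicator_open[OF U(1)] by blast
qed

lemma trig_closure_sum:
  "(\<And>i. i \<in> I \<Longrightarrow> trig_closure (f i)) \<Longrightarrow> trig_closure (\<lambda>x. \<Sum>i\<in>I. f i x)"
  by (induction I rule: infinite_finite_induct)
     (auto intro: trig_closure_add trig_closure_poly trig_poly_const)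

lemma trig_closure_cong:
  assumes "\<And>x. x \<in> Q0 \<Longrightarrow> f x = g x"
  shows "trig_closure f \<longleftrightarrow> trig_closure g"
proof -
  have "f \<in> L2_space (lebesgue_on Q0) \<longleftrightarrow> g \<in> L2_space (lebesgue_on Q0)"
    unfolding L2_space_iff using assms
    by (intro conj_cong measurable_cong Bochner_Integration.integrable_cong) auto
  moreover have "(\<integral>x. (cmod (f x - t x))\<^sup>2 \<partial>lebesgue_on Q0) = (\<integral>x. (cmod (g x - t x))\<^sup>2 \<partial>lebesgue_on Q0)" for t
    using assms by (intro Bochner_Integration.integral_cong) auto
  ultimately show ?thesis by (simp add: trig_closure_def)
qed

text \<open>A measurable function is a pointwise limit of simple functions; measuring distances from
  the base point 0 keeps them below 2 |f|, which is square integrable. Each simple function is a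
  finite combination of indicators on \<open>Q0\<close>.\<close>

lemma trig_closure_L2:
  assumes f: "f \<in> L2_space (lebesgue_on Q0)"
  shows "trig_closure f"
proof -
  have [measurable]: "f \<in> borel_measurable (lebesgue_on Q0)"
    using f by (simp add: L2_space_iff)
  obtain s where s: "\<And>i. simple_function (lebesgue_on Q0) (s i)"
    "\<And>x. x \<in> Q0 \<Longrightarrow> (\<lambda>i. s i x) \<longlonglongrightarrow> f x" "\<And>i x. x \<in> Q0 \<Longrightarrow> cmod (s i x) \<le> 2 * cmod (f x)"
    using borel_measurable_implies_sequence_metric[of f "lebesgue_on Q0" 0]
    by (simp add: Ball_def) metis
  have "trig_closure (s i)" for i
  proof -
    define A where "A y = s i -` {y} \<inter> Q0" for y
    have A: "A y \<in> sets lebesgue" for y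
      using simple_functionD(2)[OF s(1), of i "{y}"] by (simp add: A_def sets_restrict_space_iff)
    have "s i x = (\<Sum>y\<in>s i ` Q0. y * indicator (A y) x)" if "x \<in> Q0" for x
    proof -
      have "(\<Sum>y\<in>s i ` Q0. y * indicator (A y) x) = (\<Sum>y\<in>s i ` Q0. if y = s i x then y else 0)"
        using that by (intro sum.cong) (auto simp: A_def indicator_def)
      then show ?thesis using simple_functionD(1)[OF s(1), of i] that by simp
    qed
    then have "trig_closure (s i) \<longleftrightarrow> trig_closure (\<lambda>x. \<Sum>y\<in>s i ` Q0. y * indicator (A y) x)"
      by (rule trig_closure_cong)
    moreover have "trig_closure (\<lambda>x. \<Sum>y\<in>s i ` Q0. y * indicator (A y) x)"
      by (intro trig_closure_sum trig_closure_scale trig_closure_indicator A)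
    ultimately show ?thesis by simp
  qed
  then show ?thesis
  proof (rule trig_closure_limit)
    show "AE x in lebesgue_on Q0. (\<lambda>k. s k x) \<longlonglongrightarrow> f x" using s(2) by (intro AE_I2) simp
    show "integrable (lebesgue_on Q0) (\<lambda>x. (2 * cmod (f x))\<^sup>2)"
      using f by (simp add: L2_space_iff power_mult_distrib)
  qed (use s(3) in auto)
qed

theorem parseval_Q0:
  assumes f: "f \<in> L2_space (lebesgue_on Q0)"
  shows "((\<lambda>n. (cmod (L2_inner (lebesgue_on Q0) f (fourier n)))\<^sup>2) has_sum
    (\<integral>x. (cmod (f x))\<^sup>2 \<partial>lebesgue_on Q0)) UNIV"
proof (rule parseval_of_dense[OF fourier_L2 fourier_orthonormal f])
  fix \<epsilon> :: real assume "\<epsilon> > 0"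
  then obtain t where t: "trig_poly t" "(\<integral>x. (cmod (f x - t x))\<^sup>2 \<partial>lebesgue_on Q0) < \<epsilon>"
    using trig_closure_L2[OF f] by (auto simp: trig_closure_def)
  obtain J a where "finite J" "t = (\<lambda>x. \<Sum>n\<in>J. a n * fourier n x)"
    using trig_poly_expansion[OF t(1)] .
  then show "\<exists>J a. finite J \<and> (\<integral>x. (cmod (f x - (\<Sum>n\<in>J. a n * fourier n x)))\<^sup>2 \<partial>lebesgue_on Q0) < \<epsilon>"
    using t(2) by blast
qed

section \<open>Decomposition of \<open>Q\<close> into unit cubes\<close>

lemma L2_space_cnj: "f \<in> L2_space \<mu> \<Longrightarrow> (\<lambda>x. cnj (f x)) \<in> L2_space \<mu>"
  unfolding L2_space_iff
  by (auto intro!: measurable_compose[of f _ borel] borel_measurable_continuous_onI continuous_intros)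

lemma L2_space_mult_bounded:
  assumes f: "f \<in> L2_space \<mu>" and g: "g \<in> borel_measurable \<mu>" and "\<And>x. cmod (g x) \<le> 1"
  shows "(\<lambda>x. g x * f x) \<in> L2_space \<mu>"
proof -
  note [measurable] = g
  have [measurable]: "f \<in> borel_measurable \<mu>" and int: "integrable \<mu> (\<lambda>x. (cmod (f x))\<^sup>2)"
    using f by (auto simp: L2_space_iff)
  have "(cmod (g x) * cmod (f x))\<^sup>2 \<le> (cmod (f x))\<^sup>2" for x
    using assms(3)[of x] by (intro power_mono) (auto simp: mult_left_le_one_le)
  then have "integrable \<mu> (\<lambda>x. (cmod (g x * f x))\<^sup>2)"
    by (intro Bochner_Integration.integrable_bound[OF int]) (auto simp: norm_mult)
  then show ?thesis by (simp add: L2_space_iff)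
qed

lemma norm_vec_squared: "(norm (v::complex^'n))\<^sup>2 = (\<Sum>i\<in>UNIV. (cmod (v $ i))\<^sup>2)"
  by (simp add: norm_vec_def L2_set_def sum_nonneg)

lemma integral_norm_vec_squared:
  fixes F :: "'a \<Rightarrow> complex^'n"
  assumes "\<And>i. (\<lambda>x. F x $ i) \<in> L2_space \<mu>"
  shows "integrable \<mu> (\<lambda>x. (norm (F x))\<^sup>2)"
    and "(\<integral>x. (norm (F x))\<^sup>2 \<partial>\<mu>) = (\<Sum>i\<in>UNIV. \<integral>x. (cmod (F x $ i))\<^sup>2 \<partial>\<mu>)"
  unfolding norm_vec_squared
  using assms by (auto simp: L2_space_iff intro!: Bochner_Integration.integral_sum)

lemma L2_space_matrix_vector:
  fixes F :: "'a \<Rightarrow> complex^'n" and A :: "complex^'n^'m"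
  assumes "\<And>i. (\<lambda>x. F x $ i) \<in> L2_space \<mu>"
  shows "(\<lambda>x. (A *v F x) $ i) \<in> L2_space \<mu>"
  unfolding matrix_vector_mult_def using assms
  by (simp add: L2_space_sum L2_space_scale)

text \<open>Applied to \<open>Gamma_matrix\<close> for the frame bounds and to its transpose for the
  Riesz bounds.\<close>

lemma integral_matrix_vector_bounds:
  fixes F :: "'a \<Rightarrow> complex^'n" and A :: "complex^'n^'m"
  assumes F: "\<And>i. (\<lambda>x. F x $ i) \<in> L2_space \<mu>"
    and bounds: "\<And>v. a * (norm v)\<^sup>2 \<le> (norm (A *v v))\<^sup>2" "\<And>v. (norm (A *v v))\<^sup>2 \<le> b * (norm v)\<^sup>2"
  shows "a * (\<integral>x. (norm (F x))\<^sup>2 \<partial>\<mu>) \<le> (\<integral>x. (norm (A *v F x))\<^sup>2 \<partial>\<mu>)"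
    and "(\<integral>x. (norm (A *v F x))\<^sup>2 \<partial>\<mu>) \<le> b * (\<integral>x. (norm (F x))\<^sup>2 \<partial>\<mu>)"
proof -
  have int: "integrable \<mu> (\<lambda>x. (norm (F x))\<^sup>2)" "integrable \<mu> (\<lambda>x. (norm (A *v F x))\<^sup>2)"
    by (intro integral_norm_vec_squared L2_space_matrix_vector F)+
  have "(\<integral>x. a * (norm (F x))\<^sup>2 \<partial>\<mu>) \<le> (\<integral>x. (norm (A *v F x))\<^sup>2 \<partial>\<mu>)"
    using int by (intro integral_mono bounds) auto
  then show "a * (\<integral>x. (norm (F x))\<^sup>2 \<partial>\<mu>) \<le> (\<integral>x. (norm (A *v F x))\<^sup>2 \<partial>\<mu>)" by simp
  have "(\<integral>x. (norm (A *v F x))\<^sup>2 \<partial>\<mu>) \<le> (\<integral>x. b * (norm (F x))\<^sup>2 \<partial>\<mu>)"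
    using int by (intro integral_mono bounds) auto
  then show "(\<integral>x. (norm (A *v F x))\<^sup>2 \<partial>\<mu>) \<le> b * (\<integral>x. (norm (F x))\<^sup>2 \<partial>\<mu>)" by simp
qed

section \<open>Translations of Lebesgue measure and the cubes that form Q\<close>

lemma measurable_lebesgue_translation: "(\<lambda>x. x + a) \<in> lebesgue \<rightarrow>\<^sub>M lebesgue"
proof (rule measurableI)
  fix S :: "'a set" assume "S \<in> sets lebesgue"
  then have "(\<lambda>x. - a + x) ` S \<in> sets lebesgue" by (rule lebesgue_sets_translation)
  \<comment> \<open>The preimage under a translation is a translate in the opposite direction. This
    handles all Lebesgue sets, whereas continuity alone speaks of Borel sets.\<close>
  moreover have "(\<lambda>x. - a + x) ` S = (\<lambda>x. x + a) -` S \<inter> space lebesgue"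
    by (force simp: image_iff)
  ultimately show "(\<lambda>x. x + a) -` S \<inter> space lebesgue \<in> sets lebesgue" by simp
qed simp

lemma distr_lebesgue_translation: "distr lebesgue lebesgue (\<lambda>x. x + a) = lebesgue"
proof (rule measure_eqI)
  fix S :: "'a set" assume "S \<in> sets (distr lebesgue lebesgue (\<lambda>x. x + a))"
  then have S: "S \<in> sets lebesgue" by simp
  have "(\<lambda>x. x + a) -` S = (\<lambda>x. 1 *\<^sub>R x + - a) ` S"
    by (force simp: image_iff)
  then have "emeasure lebesgue ((\<lambda>x. x + a) -` S) = emeasure lebesgue S"
    using emeasure_lebesgue_affine[of 1 "- a" S] by simp
  then show "emeasure (distr lebesgue lebesgue (\<lambda>x. x + a)) S = emeasure lebesgue S"
    using S by (simp add: emeasure_distr[OF measurable_lebesgue_translation])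
qed simp

definition cube_at :: "int^'d \<Rightarrow> (real^'d) set" where
  "cube_at m = (\<lambda>x. x + real_vec m) ` Q0"

lemma cube_at_iff [simp]: "x + real_vec m \<in> cube_at m \<longleftrightarrow> x \<in> Q0"
  by (auto simp: cube_at_def)

lemma cube_at_lmeasurable: "cube_at m \<in> lmeasurable"
proof -
  have "Q0 \<in> (lmeasurable :: (real^'d) set set)"
    using Q0_bounds(2) bounded_subset[OF bounded_cbox] by (intro bounded_set_imp_lmeasurable) auto
  then have "(+) (real_vec m) ` Q0 \<in> lmeasurable" by (rule measurable_translation)
  then show ?thesis by (simp add: cube_at_def add.commute[of _ "real_vec m"])
qed

lemma cube_at_sets: "cube_at m \<in> sets lebesgue"
  using cube_at_lmeasurable by (rule fmeasurableD)

lemma Q_union_eq: "Q_union M = (\<Union>p. cube_at (M p))"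
  by (simp add: Q_union_def cube_at_def)

lemma Q_union_lmeasurable: "Q_union (M :: 'n::finite \<Rightarrow> int^'d) \<in> lmeasurable"
  unfolding Q_union_eq by (intro fmeasurable.finite_UN cube_at_lmeasurable) auto

lemma Q_union_sets: "Q_union (M :: 'n::finite \<Rightarrow> int^'d) \<in> sets lebesgue"
  using Q_union_lmeasurable by (rule fmeasurableD)

lemma measurable_translate_Q0:
  assumes "cube_at m \<subseteq> S"
  shows "(\<lambda>x. x + real_vec m) \<in> lebesgue_on Q0 \<rightarrow>\<^sub>M lebesgue_on S"
  using assms cube_at_iff
  by (intro measurable_restrict_space3 measurable_lebesgue_translation) blast

text \<open>Extending f by zero outside the cube gives a function g on the whole space, to which
  translation invariance of Lebesgue measure applies; the shifted g is supported in
  \<open>Q0\<close>.\<close>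

lemma
  fixes f :: "real^'d \<Rightarrow> 'b::{banach, second_countable_topology}"
  assumes S: "S \<in> sets lebesgue" "cube_at m \<subseteq> S"
    and f: "integrable (lebesgue_on S) f"
  shows integrable_translate_Q0: "integrable (lebesgue_on Q0) (\<lambda>x. f (x + real_vec m))"
    and integral_cube_at: "(\<integral>x. indicator (cube_at m) x *\<^sub>R f x \<partial>lebesgue) = (\<integral>x. f (x + real_vec m) \<partial>lebesgue_on Q0)"
    and integrable_cube_at: "integrable lebesgue (\<lambda>x. indicator (cube_at m) x *\<^sub>R f x)"
proof -
  define g where "g x = indicator (cube_at m) x *\<^sub>R f x" for x
  have "integrable lebesgue (\<lambda>x. indicator S x *\<^sub>R f x)"
    using f S(1) by (simp add: integrable_restrict_space)
  then have "integrable lebesgue (\<lambda>x. indicator (cube_at m) x *\<^sub>R (indicator S x *\<^sub>R f x))"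
    by (rule integrable_mult_indicator[OF cube_at_sets])
  moreover have "indicator (cube_at m) x *\<^sub>R (indicator S x *\<^sub>R f x) = g x" for x
    by (use S(2) in \<open>auto simp: g_def indicator_def\<close>)
  ultimately have g: "integrable lebesgue g" by simp
  then show "integrable lebesgue (\<lambda>x. indicator (cube_at m) x *\<^sub>R f x)" by (simp add: g_def[abs_def])
  have shift: "g (x + real_vec m) = indicator Q0 x *\<^sub>R f (x + real_vec m)" for x
    by (simp add: g_def indicator_def)
  have "integrable (distr lebesgue lebesgue (\<lambda>x. x + real_vec m)) g"
    using g by (simp add: distr_lebesgue_translation)
  then have "integrable lebesgue (\<lambda>x. g (x + real_vec m))"
    by (rule integrable_distr[OF measurable_lebesgue_translation])
  then show "integrable (lebesgue_on Q0) (\<lambda>x. f (x + real_vec m))"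
    unfolding shift by (subst integrable_restrict_space) auto
  have "(\<integral>x. g x \<partial>lebesgue) = (\<integral>x. g x \<partial>distr lebesgue lebesgue (\<lambda>x. x + real_vec m))"
    by (simp add: distr_lebesgue_translation)
  also have "\<dots> = (\<integral>x. g (x + real_vec m) \<partial>lebesgue)"
    using g by (intro integral_distr measurable_lebesgue_translation) auto
  also have "\<dots> = (\<integral>x. f (x + real_vec m) \<partial>lebesgue_on Q0)"
    unfolding shift by (subst integral_restrict_space) auto
  finally show "(\<integral>x. indicator (cube_at m) x *\<^sub>R f x \<partial>lebesgue) = (\<integral>x. f (x + real_vec m) \<partial>lebesgue_on Q0)"
    by (simp add: g_def)
qed

lemma L2_translate_Q0:
  assumes S: "S \<in> sets lebesgue" "cube_at m \<subseteq> S" and f: "f \<in> L2_space (lebesgue_on S)"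
  shows "(\<lambda>x. f (x + real_vec m)) \<in> L2_space (lebesgue_on Q0)"
proof -
  have "f \<in> borel_measurable (lebesgue_on S)" "integrable (lebesgue_on S) (\<lambda>x. (cmod (f x))\<^sup>2)"
    using f by (auto simp: L2_space_iff)
  then show ?thesis
    using measurable_compose[OF measurable_translate_Q0[OF S(2)]] integrable_translate_Q0[OF S]
    unfolding L2_space_iff by blast
qed

text \<open>The cubes are half-open, so two points of \<open>Q0\<close> differ by less than 1 in
  each coordinate; an integer difference must be 0.\<close>

lemma cube_at_disjoint:
  assumes "x \<in> cube_at m" "x \<in> cube_at n"
  shows "m = n"
proof -
  obtain y z where yz: "y \<in> Q0" "z \<in> Q0" "y + real_vec m = z + real_vec n"
    using assms by (auto simp: cube_at_def)
  have "m $ i = n $ i" for i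
  proof -
    have "y $ i + of_int (m $ i) = z $ i + of_int (n $ i)"
      using arg_cong[OF yz(3), of "\<lambda>v. v $ i"] by (simp add: real_vec_def)
    moreover have "-1/2 \<le> y $ i" "y $ i < 1/2" "-1/2 \<le> z $ i" "z $ i < 1/2"
      using yz(1,2) by (auto simp: Q0_def)
    ultimately have "real_of_int (m $ i) < of_int (n $ i) + 1" "real_of_int (n $ i) < of_int (m $ i) + 1"
      by linarith+
    then show ?thesis by linarith
  qed
  then show ?thesis by (simp add: vec_eq_iff)
qed

lemma cube_at_subset_Q_union: "cube_at (M p) \<subseteq> Q_union M"
  by (auto simp: Q_union_eq)

lemma integral_Q_union:
  fixes M :: "'n::finite \<Rightarrow> int^'d" and f :: "real^'d \<Rightarrow> 'b::{banach, second_countable_topology}"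
  assumes inj: "inj M" and f: "integrable (lebesgue_on (Q_union M)) f"
  shows "(\<integral>x. f x \<partial>lebesgue_on (Q_union M)) = (\<Sum>p\<in>UNIV. \<integral>x. f (x + real_vec (M p)) \<partial>lebesgue_on Q0)"
proof -
  \<comment> \<open>Distinct translation vectors give disjoint cubes, so at a point of Q exactly one
    summand is present.\<close>
  have ind: "indicator (Q_union M) x *\<^sub>R f x = (\<Sum>p\<in>UNIV. indicator (cube_at (M p)) x *\<^sub>R f x)" for x
  proof (cases "x \<in> Q_union M")
    case True
    then obtain q where q: "x \<in> cube_at (M q)" by (auto simp: Q_union_eq)
    then have "x \<in> cube_at (M p) \<longleftrightarrow> p = q" for p
      using cube_at_disjoint injD[OF inj] by metis
    then have "(\<Sum>p\<in>UNIV. indicator (cube_at (M p)) x *\<^sub>R f x) = (\<Sum>p\<in>UNIV. if p = q then f x else 0)"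
      by (intro sum.cong) (auto simp: indicator_def)
    then show ?thesis using True by simp
  qed (auto simp: Q_union_eq indicator_def)
  have "(\<integral>x. f x \<partial>lebesgue_on (Q_union M)) = (\<integral>x. indicator (Q_union M) x *\<^sub>R f x \<partial>lebesgue)"
    by (rule integral_restrict_space) (simp add: Q_union_sets)
  also have "\<dots> = (\<Sum>p\<in>UNIV. \<integral>x. indicator (cube_at (M p)) x *\<^sub>R f x \<partial>lebesgue)"
    unfolding ind by (rule Bochner_Integration.integral_sum) (rule integrable_cube_at[OF Q_union_sets cube_at_subset_Q_union f])
  finally show ?thesis by (simp add: integral_cube_at[OF Q_union_sets cube_at_subset_Q_union f])
qed

section \<open>The exponential family\<close>

lemma exp_family_eq: "exp_family \<delta> (j, n) x = cis (2 * pi * ((real_vec n + \<delta> j) \<bullet> x))"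
  by (simp add: exp_family_def cis_conv_exp mult_ac)

text \<open>All dependence on the cube p sits in one matrix entry; the remaining factor is the same
  on every cube.\<close>

lemma exp_family_translate:
  "exp_family \<delta> (j, n) (x + real_vec (M p))
    = Gamma_matrix \<delta> M $ j $ p * (cis (2 * pi * (\<delta> j \<bullet> x)) * fourier n x)"
proof -
  have "exp_family \<delta> (j, n) (x + real_vec (M p))
      = cis (2 * pi * (\<delta> j \<bullet> real_vec (M p))) * cis (2 * pi * (\<delta> j \<bullet> x)) * fourier n (x + real_vec (M p))"
    by (simp add: exp_family_eq fourier_def cis_mult inner_add_left inner_add_right algebra_simps)
  also have "cis (2 * pi * (\<delta> j \<bullet> real_vec (M p))) = Gamma_matrix \<delta> M $ j $ p"
    by (simp add: Gamma_matrix_def cis_conv_exp mult_ac)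
  finally show ?thesis by (simp add: fourier_add_real_vec mult.assoc)
qed

lemma measurable_lebesgue_on_borel: "f \<in> borel_measurable borel \<Longrightarrow> f \<in> borel_measurable (lebesgue_on S)"
  by (intro measurable_restrict_space1 measurable_completion) simp

lemma exp_family_L2: "exp_family \<delta> k \<in> L2_space (lebesgue_on (Q_union (M :: 'n::finite \<Rightarrow> int^'d)))"
proof (rule L2_space_bounded)
  show "finite_measure (lebesgue_on (Q_union M))"
    by (rule finite_measure_lebesgue_on[OF Q_union_lmeasurable])
  obtain j n where k: "k = (j, n)" by (cases k)
  have "exp_family \<delta> k = (\<lambda>x. cis (2 * pi * ((real_vec n + \<delta> j) \<bullet> x)))"
    by (simp add: fun_eq_iff k exp_family_eq)
  then show "exp_family \<delta> k \<in> borel_measurable (lebesgue_on (Q_union M))"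
    by (auto intro!: measurable_lebesgue_on_borel borel_measurable_continuous_onI continuous_intros)
  show "cmod (exp_family \<delta> k x) \<le> 1" for x by (simp add: k exp_family_eq)
qed

text \<open>Read on \<open>Q0\<close>, this turns functions on Q into vector functions on a single
  cube; for pairwise distinct translations it preserves the L^2 norm, see
  \<open>L2_norm_Q_union\<close>.\<close>

definition fiber :: "('n \<Rightarrow> int^'d) \<Rightarrow> (real^'d \<Rightarrow> complex) \<Rightarrow> real^'d \<Rightarrow> complex^'n" where
  "fiber M f x = (\<chi> p. f (x + real_vec (M p)))"

lemma fiber_L2:
  fixes M :: "'n::finite \<Rightarrow> int^'d"
  assumes "f \<in> L2_space (lebesgue_on (Q_union M))"
  shows "(\<lambda>x. fiber M f x $ p) \<in> L2_space (lebesgue_on Q0)"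
  using L2_translate_Q0[OF Q_union_sets cube_at_subset_Q_union assms] by (simp add: fiber_def)

lemma L2_norm_Q_union:
  fixes M :: "'n::finite \<Rightarrow> int^'d"
  assumes "inj M" and f: "f \<in> L2_space (lebesgue_on (Q_union M))"
  shows "(L2_norm (lebesgue_on (Q_union M)) f)\<^sup>2 = (\<integral>x. (norm (fiber M f x))\<^sup>2 \<partial>lebesgue_on Q0)"
proof -
  have "integrable (lebesgue_on (Q_union M)) (\<lambda>x. (cmod (f x))\<^sup>2)" using f by (simp add: L2_space_iff)
  then show ?thesis
    unfolding L2_norm_squared integral_norm_vec_squared(2)[OF fiber_L2[OF f]]
    by (subst integral_Q_union[OF \<open>inj M\<close>]) (simp_all add: fiber_def)
qed

text \<open>The conjugates appear because the functions of the family occur in the second argument of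
  the inner product; they do not affect absolute values.\<close>

lemma L2_inner_exp_family:
  fixes M :: "'n::finite \<Rightarrow> int^'d"
  assumes "inj M" and f: "f \<in> L2_space (lebesgue_on (Q_union M))"
  shows "L2_inner (lebesgue_on (Q_union M)) f (exp_family \<delta> (j, n))
    = L2_inner (lebesgue_on Q0)
        (\<lambda>x. cnj (cis (2 * pi * (\<delta> j \<bullet> x)) * (Gamma_matrix \<delta> M *v fiber M (\<lambda>y. cnj (f y)) x) $ j)) (fourier n)"
proof -
  let ?g = "\<lambda>p x. f (x + real_vec (M p)) * cnj (exp_family \<delta> (j, n) (x + real_vec (M p)))"
  have int: "integrable (lebesgue_on (Q_union M)) (\<lambda>x. f x * cnj (exp_family \<delta> (j, n) x))"
    by (rule integrable_L2_inner[OF f exp_family_L2])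
  have "L2_inner (lebesgue_on (Q_union M)) f (exp_family \<delta> (j, n)) = (\<Sum>p\<in>UNIV. \<integral>x. ?g p x \<partial>lebesgue_on Q0)"
    unfolding L2_inner_def by (rule integral_Q_union[OF \<open>inj M\<close> int])
  also have "\<dots> = (\<integral>x. (\<Sum>p\<in>UNIV. ?g p x) \<partial>lebesgue_on Q0)"
    by (rule Bochner_Integration.integral_sum[symmetric])
       (rule integrable_translate_Q0[OF Q_union_sets cube_at_subset_Q_union int])
  also have "\<dots> = L2_inner (lebesgue_on Q0)
        (\<lambda>x. cnj (cis (2 * pi * (\<delta> j \<bullet> x)) * (Gamma_matrix \<delta> M *v fiber M (\<lambda>y. cnj (f y)) x) $ j)) (fourier n)"
    unfolding L2_inner_def
    by (intro Bochner_Integration.integral_cong refl)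
       (simp add: exp_family_translate matrix_vector_mult_def fiber_def sum_distrib_left sum_distrib_right mult_ac)
  finally show ?thesis .
qed

lemma has_sum_finite_times:
  fixes f :: "'n::finite \<times> 'k \<Rightarrow> real"
  assumes f: "\<And>j. ((\<lambda>n. f (j, n)) has_sum s j) UNIV" and "\<And>k. f k \<ge> 0"
  shows "(f has_sum (\<Sum>j\<in>UNIV. s j)) UNIV"
proof -
  have "f summable_on (SIGMA j:UNIV. UNIV)"
    by (rule summable_on_SigmaI[where g = s]) (use assms in auto)
  then have "(f has_sum (\<Sum>j\<in>UNIV. s j)) (SIGMA j:UNIV. UNIV)"
    by (intro has_sum_SigmaI[where g = s] f) auto
  then show ?thesis by simp
qed

section \<open>Frame sums and frame constants of the exponential family\<close>

lemma has_sum_exp_family: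
  fixes M :: "'n::finite \<Rightarrow> int^'d"
  assumes "inj M" and f: "f \<in> L2_space (lebesgue_on (Q_union M))"
  shows "((\<lambda>k. (cmod (L2_inner (lebesgue_on (Q_union M)) f (exp_family \<delta> k)))\<^sup>2) has_sum
    (\<integral>x. (norm (Gamma_matrix \<delta> M *v fiber M (\<lambda>y. cnj (f y)) x))\<^sup>2 \<partial>lebesgue_on Q0)) UNIV"
proof -
  let ?G = "\<lambda>x. Gamma_matrix \<delta> M *v fiber M (\<lambda>y. cnj (f y)) x"
  have G: "(\<lambda>x. ?G x $ j) \<in> L2_space (lebesgue_on Q0)" for j
    by (intro L2_space_matrix_vector fiber_L2 L2_space_cnj f)
  have "((\<lambda>n. (cmod (L2_inner (lebesgue_on (Q_union M)) f (exp_family \<delta> (j, n))))\<^sup>2) has_sum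
      (\<integral>x. (cmod (?G x $ j))\<^sup>2 \<partial>lebesgue_on Q0)) UNIV" for j
  proof -
    have "(\<lambda>x. cnj (cis (2 * pi * (\<delta> j \<bullet> x)) * ?G x $ j)) \<in> L2_space (lebesgue_on Q0)"
      by (intro L2_space_cnj L2_space_mult_bounded G measurable_lebesgue_on_borel
          borel_measurable_continuous_onI continuous_intros) simp
    from parseval_Q0[OF this] show ?thesis
      unfolding L2_inner_exp_family[OF assms] by (simp add: norm_mult)
  qed
  then have "((\<lambda>k. (cmod (L2_inner (lebesgue_on (Q_union M)) f (exp_family \<delta> k)))\<^sup>2) has_sum
      (\<Sum>j\<in>UNIV. \<integral>x. (cmod (?G x $ j))\<^sup>2 \<partial>lebesgue_on Q0)) UNIV"
    by (intro has_sum_finite_times) auto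
  then show ?thesis by (simp only: integral_norm_vec_squared(2)[OF G])
qed

text \<open>The integral of the character of frequency 0. Unit volume is what keeps extra factors
  out of the frame constants when constant fibers are tested.\<close>

lemma measure_Q0: "measure (lebesgue_on (Q0 :: (real^'d) set)) Q0 = 1"
  using integral_fourier[of "0 :: int^'d"] by (simp add: of_real_eq_1_iff scaleR_conv_of_real)

text \<open>Step functions, constant on each cube, are the test functions that turn a frame
  inequality into a matrix inequality at the vector v.\<close>

lemma fiber_constant_exists:
  fixes M :: "'n::finite \<Rightarrow> int^'d"
  assumes "inj M"
  obtains w where "w \<in> L2_space (lebesgue_on (Q_union M))" "\<And>x. x \<in> Q0 \<Longrightarrow> fiber M w x = v"
proof
  define w where "w x = (\<Sum>p\<in>UNIV. v $ p * indicator (cube_at (M p)) x)" for x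
  show "w \<in> L2_space (lebesgue_on (Q_union M))"
    unfolding w_def
  proof (intro L2_space_sum L2_space_scale)
    show "(\<lambda>x. indicator (cube_at (M p)) x :: complex) \<in> L2_space (lebesgue_on (Q_union M))" for p
      by (intro L2_space_bounded[OF finite_measure_lebesgue_on[OF Q_union_lmeasurable], of _ _ 1]
          measurable_restrict_space1 borel_measurable_indicator cube_at_sets) (auto simp: indicator_def)
  qed
  show "fiber M w x = v" if "x \<in> Q0" for x
  proof -
    have "w (x + real_vec (M q)) = v $ q" for q
    proof -
      have "x + real_vec (M q) \<in> cube_at (M p) \<longleftrightarrow> p = q" for p
        using that cube_at_disjoint injD[OF assms] cube_at_iff by metis
      then have "w (x + real_vec (M q)) = (\<Sum>p\<in>UNIV. if p = q then v $ q else 0)"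
        unfolding w_def by (intro sum.cong) (auto simp: indicator_def)
      then show ?thesis by simp
    qed
    then show ?thesis by (simp add: fiber_def vec_eq_iff)
  qed
qed

lemma norm_fiber_cnj: "norm (fiber M (\<lambda>y. cnj (f y)) x) = norm (fiber M f x)"
  by (simp add: norm_vec_def fiber_def)

text \<open>Integrating the pointwise matrix bounds gives one direction, testing with step functions
  the other. Both keep A and B unchanged, so optimality becomes a question about the matrix.\<close>

lemma frame_constants_exp_family_iff:
  fixes M :: "'n::finite \<Rightarrow> int^'d"
  assumes "inj M"
  shows "frame_constants (lebesgue_on (Q_union M)) UNIV (exp_family \<delta>) A B \<longleftrightarrow>
    0 < A \<and> 0 < B \<and> (\<forall>v. A * (norm v)\<^sup>2 \<le> (norm (Gamma_matrix \<delta> M *v v))\<^sup>2 \<and>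
                         (norm (Gamma_matrix \<delta> M *v v))\<^sup>2 \<le> B * (norm v)\<^sup>2)"
    (is "_ \<longleftrightarrow> 0 < A \<and> 0 < B \<and> ?R")
proof -
  let ?\<mu> = "lebesgue_on (Q_union M)" and ?\<Gamma> = "Gamma_matrix \<delta> M"
  let ?S = "\<lambda>w. \<integral>x. (norm (?\<Gamma> *v fiber M (\<lambda>y. cnj (w y)) x))\<^sup>2 \<partial>lebesgue_on Q0"
  have sum: "(\<lambda>k. (cmod (L2_inner ?\<mu> w (exp_family \<delta> k)))\<^sup>2) summable_on UNIV"
    "(\<Sum>\<^sub>\<infinity>k. (cmod (L2_inner ?\<mu> w (exp_family \<delta> k)))\<^sup>2) = ?S w" if "w \<in> L2_space ?\<mu>" for w
    using has_sum_exp_family[OF assms that] by (auto simp: summable_on_def dest: infsumI)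
  have norm: "(L2_norm ?\<mu> w)\<^sup>2 = (\<integral>x. (norm (fiber M (\<lambda>y. cnj (w y)) x))\<^sup>2 \<partial>lebesgue_on Q0)"
    if "w \<in> L2_space ?\<mu>" for w
    by (simp only: L2_norm_Q_union[OF assms that] norm_fiber_cnj)
  have iff: "frame_constants ?\<mu> UNIV (exp_family \<delta>) A B \<longleftrightarrow> 0 < A \<and> 0 < B \<and>
      (\<forall>w\<in>L2_space ?\<mu>. A * (L2_norm ?\<mu> w)\<^sup>2 \<le> ?S w \<and> ?S w \<le> B * (L2_norm ?\<mu> w)\<^sup>2)"
    by (simp add: frame_constants_def sum)
  have "(\<forall>w\<in>L2_space ?\<mu>. A * (L2_norm ?\<mu> w)\<^sup>2 \<le> ?S w \<and> ?S w \<le> B * (L2_norm ?\<mu> w)\<^sup>2) \<longleftrightarrow> ?R"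
  proof
    assume R: ?R
    show "\<forall>w\<in>L2_space ?\<mu>. A * (L2_norm ?\<mu> w)\<^sup>2 \<le> ?S w \<and> ?S w \<le> B * (L2_norm ?\<mu> w)\<^sup>2"
    proof
      fix w assume w: "w \<in> L2_space ?\<mu>"
      show "A * (L2_norm ?\<mu> w)\<^sup>2 \<le> ?S w \<and> ?S w \<le> B * (L2_norm ?\<mu> w)\<^sup>2"
        unfolding norm[OF w]
        using integral_matrix_vector_bounds[OF fiber_L2[OF L2_space_cnj[OF w]], of A ?\<Gamma> B] R by simp
    qed
  next
    assume L: "\<forall>w\<in>L2_space ?\<mu>. A * (L2_norm ?\<mu> w)\<^sup>2 \<le> ?S w \<and> ?S w \<le> B * (L2_norm ?\<mu> w)\<^sup>2"
    show ?R
    proof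
      fix v :: "complex^'n"
      \<comment> \<open>The frame sum involves the fiber of the conjugate of w, so the entries of v
        are conjugated in advance.\<close>
      obtain w where w: "w \<in> L2_space ?\<mu>" "\<And>x. x \<in> Q0 \<Longrightarrow> fiber M w x = (\<chi> p. cnj (v $ p))"
        using fiber_constant_exists[OF assms] by blast
      have cnj: "fiber M (\<lambda>y. cnj (w y)) x = v" if "x \<in> Q0" for x
        using w(2)[OF that] by (simp add: fiber_def vec_eq_iff)
      have const: "(\<integral>x. h (fiber M (\<lambda>y. cnj (w y)) x) \<partial>lebesgue_on Q0) = h v" for h :: "complex^'n \<Rightarrow> real"
      proof -
        have "(\<integral>x. h (fiber M (\<lambda>y. cnj (w y)) x) \<partial>lebesgue_on Q0) = (\<integral>x. h v \<partial>lebesgue_on (Q0 :: (real^'d) set))"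
          by (intro Bochner_Integration.integral_cong) (auto simp: cnj)
        then show ?thesis by (simp add: measure_Q0)
      qed
      show "A * (norm v)\<^sup>2 \<le> (norm (?\<Gamma> *v v))\<^sup>2 \<and> (norm (?\<Gamma> *v v))\<^sup>2 \<le> B * (norm v)\<^sup>2"
        using bspec[OF L w(1)] unfolding norm[OF w(1)] const[of "\<lambda>u. (norm u)\<^sup>2"]
          const[of "\<lambda>u. (norm (?\<Gamma> *v u))\<^sup>2"] .
    qed
  qed
  then show ?thesis using iff by blast
qed

section \<open>Finite combinations and Riesz bounds\<close>

lemma L2_norm_combination_exp_family:
  fixes M :: "'n::finite \<Rightarrow> int^'d" and a :: "'n \<times> (int^'d) \<Rightarrow> complex"
  assumes "inj M" "finite J"
  obtains U :: "real^'d \<Rightarrow> complex^'n"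
  where "\<And>j. (\<lambda>x. U x $ j) \<in> L2_space (lebesgue_on Q0)"
    "(\<integral>x. (norm (U x))\<^sup>2 \<partial>lebesgue_on Q0) = (\<Sum>k\<in>J. (cmod (a k))\<^sup>2)"
    "(L2_norm (lebesgue_on (Q_union M)) (\<lambda>x. \<Sum>k\<in>J. a k * exp_family \<delta> k x))\<^sup>2
      = (\<integral>x. (norm (transpose (Gamma_matrix \<delta> M) *v U x))\<^sup>2 \<partial>lebesgue_on Q0)"
proof
  \<comment> \<open>J is an arbitrary finite set of pairs; slicing it by j collects, for each shift,
    the coefficients of one trigonometric polynomial. The components of U are these polynomials
    times a factor of modulus one.\<close>
  define J' where "J' j = {n. (j, n) \<in> J}" for j
  define t where "t j x = (\<Sum>n\<in>J' j. a (j, n) * fourier n x)" for j x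
  define U where "U x = (\<chi> j. cis (2 * pi * (\<delta> j \<bullet> x)) * t j x)" for x
  have fin: "finite (J' j)" for j
    unfolding J'_def using finite_imageI[OF assms(2), of snd] by (rule finite_subset[rotated]) force
  have J: "J = (SIGMA j:UNIV. J' j)" by (auto simp: J'_def)
  have sumJ: "(\<Sum>k\<in>J. f k) = (\<Sum>j\<in>UNIV. \<Sum>n\<in>J' j. f (j, n))" for f :: "_ \<Rightarrow> 'c::comm_monoid_add"
    unfolding J by (subst sum.Sigma) (auto simp: fin)
  have t: "t j \<in> L2_space (lebesgue_on Q0)" for j
    unfolding t_def by (intro L2_space_sum L2_space_scale fourier_L2)
  show U: "(\<lambda>x. U x $ j) \<in> L2_space (lebesgue_on Q0)" for j
    unfolding U_def
    by (simp, intro L2_space_mult_bounded t measurable_lebesgue_on_borel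
          borel_measurable_continuous_onI continuous_intros) simp
  have "(\<integral>x. (cmod (U x $ j))\<^sup>2 \<partial>lebesgue_on Q0) = (\<Sum>n\<in>J' j. (cmod (a (j, n)))\<^sup>2)" for j
    using integral_orthonormal_combination[OF fourier_L2 fourier_orthonormal fin, of "\<lambda>n. a (j, n)"]
    by (simp add: U_def norm_mult t_def)
  then show "(\<integral>x. (norm (U x))\<^sup>2 \<partial>lebesgue_on Q0) = (\<Sum>k\<in>J. (cmod (a k))\<^sup>2)"
    by (simp add: integral_norm_vec_squared(2)[OF U] sumJ)
  have "(\<lambda>x. \<Sum>k\<in>J. a k * exp_family \<delta> k x) \<in> L2_space (lebesgue_on (Q_union M))"
    by (intro L2_space_sum L2_space_scale exp_family_L2)
  \<comment> \<open>For a combination the sum runs over j, the row index of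
    \<open>Gamma_matrix\<close>, while p is fixed; this is why the transpose appears.\<close>
  moreover have "fiber M (\<lambda>x. \<Sum>k\<in>J. a k * exp_family \<delta> k x) x = transpose (Gamma_matrix \<delta> M) *v U x" for x
    by (simp add: vec_eq_iff fiber_def matrix_vector_mult_def transpose_def U_def t_def sumJ
        exp_family_translate sum_distrib_left mult_ac)
  ultimately show "(L2_norm (lebesgue_on (Q_union M)) (\<lambda>x. \<Sum>k\<in>J. a k * exp_family \<delta> k x))\<^sup>2
      = (\<integral>x. (norm (transpose (Gamma_matrix \<delta> M) *v U x))\<^sup>2 \<partial>lebesgue_on Q0)"
    by (simp only: L2_norm_Q_union[OF assms(1)])
qed

lemma Min_singular_values_pos:
  assumes "invertible (A :: complex^'n^'n)"
  shows "0 < Min (singular_values A)"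
proof -
  obtain v where v: "v \<noteq> 0" "conj_transpose A *v (A *v v) = Min (singular_values A) *\<^sub>R v"
    using singular_value_bounds(1)[of A] by (auto simp: singular_values_iff)
  then have "A *v v \<noteq> 0" using assms by (auto simp: invertible_complex_iff)
  then have "0 < Min (singular_values A) * (norm v)\<^sup>2"
    using norm_matrix_singular_vector[OF v(2)] by (metis zero_less_norm_iff zero_less_power)
  then show ?thesis by (simp add: zero_less_mult_iff)
qed

lemma Max_singular_values_pos:
  assumes "invertible (A :: complex^'n^'n)"
  shows "0 < Max (singular_values A)"
  using Min_singular_values_pos[OF assms] Max_ge[OF finite_singular_values singular_value_bounds(1)[of A]]
  by linarith

text \<open>The extreme singular values of the transpose serve as Riesz bounds. They are positive
  because the transpose has the same nonzero determinant.\<close>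

lemma is_riesz_sequence_exp_family:
  fixes M :: "'n::finite \<Rightarrow> int^'d"
  assumes "inj M" "invertible (Gamma_matrix \<delta> M)"
  shows "is_riesz_sequence (lebesgue_on (Q_union M)) UNIV (exp_family \<delta>)"
proof -
  let ?\<Gamma> = "transpose (Gamma_matrix \<delta> M)"
  let ?A = "Min (singular_values ?\<Gamma>)" and ?B = "Max (singular_values ?\<Gamma>)"
  have inv: "invertible ?\<Gamma>" using assms(2) by (simp add: invertible_det_nz)
  have "?A * (\<Sum>k\<in>J. (cmod (a k))\<^sup>2) \<le> (L2_norm (lebesgue_on (Q_union M)) (\<lambda>x. \<Sum>k\<in>J. a k * exp_family \<delta> k x))\<^sup>2 \<and>
      (L2_norm (lebesgue_on (Q_union M)) (\<lambda>x. \<Sum>k\<in>J. a k * exp_family \<delta> k x))\<^sup>2 \<le> ?B * (\<Sum>k\<in>J. (cmod (a k))\<^sup>2)"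
    if "finite J" for J and a :: "'n \<times> (int^'d) \<Rightarrow> complex"
  proof -
    obtain U :: "real^'d \<Rightarrow> complex^'n" where U: "\<And>j. (\<lambda>x. U x $ j) \<in> L2_space (lebesgue_on Q0)"
      "(\<integral>x. (norm (U x))\<^sup>2 \<partial>lebesgue_on Q0) = (\<Sum>k\<in>J. (cmod (a k))\<^sup>2)"
      "(L2_norm (lebesgue_on (Q_union M)) (\<lambda>x. \<Sum>k\<in>J. a k * exp_family \<delta> k x))\<^sup>2
        = (\<integral>x. (norm (?\<Gamma> *v U x))\<^sup>2 \<partial>lebesgue_on Q0)"
      by (rule L2_norm_combination_exp_family[OF assms(1) \<open>finite J\<close>, of a \<delta>], rule that) assumption+
    show ?thesis
      unfolding U(3) U(2)[symmetric]
      using integral_matrix_vector_bounds[OF U(1) singular_value_bounds(3)[of ?\<Gamma>] singular_value_bounds(4)[of ?\<Gamma>]]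
      by (rule conjI)
  qed
  then show ?thesis
    unfolding is_riesz_sequence_def L2_family_def
    using Min_singular_values_pos[OF inv] Max_singular_values_pos[OF inv]
    by (intro conjI exI[of _ ?A] exI[of _ ?B]) (simp_all add: exp_family_L2)
qed

theorem theorem1p1:
  fixes M :: "'n::finite \<Rightarrow> int^'d::finite" and \<delta> :: "'n \<Rightarrow> real^'d"
  assumes "inj M"
  shows "(is_riesz_basis (lebesgue_on (Q_union M)) UNIV (exp_family \<delta>)
            \<longleftrightarrow> invertible (Gamma_matrix \<delta> M)) \<and>
         (is_riesz_basis (lebesgue_on (Q_union M)) UNIV (exp_family \<delta>) \<longrightarrow>
            optimal_frame_constants (lebesgue_on (Q_union M)) UNIV (exp_family \<delta>)
              (Min (singular_values (Gamma_matrix \<delta> M)))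
              (Max (singular_values (Gamma_matrix \<delta> M))))"
proof -
  let ?\<mu> = "lebesgue_on (Q_union M)" and ?\<Gamma> = "Gamma_matrix \<delta> M"
  let ?A = "Min (singular_values ?\<Gamma>)" and ?B = "Max (singular_values ?\<Gamma>)"
  have invertible: "invertible ?\<Gamma>" if basis: "is_riesz_basis ?\<mu> UNIV (exp_family \<delta>)"
  proof -
    obtain A B where "frame_constants ?\<mu> UNIV (exp_family \<delta>) A B"
      using basis by (auto simp: is_riesz_basis_def is_frame_def)
    then have A: "0 < A" "A * (norm v)\<^sup>2 \<le> (norm (?\<Gamma> *v v))\<^sup>2" for v
      by (simp_all add: frame_constants_exp_family_iff[OF assms])
    \<comment> \<open>The lower frame bound alone forces a trivial kernel, which is invertibility
      for a square matrix.\<close>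
    have "v = 0" if "?\<Gamma> *v v = 0" for v
    proof -
      have "A * (norm v)\<^sup>2 \<le> 0" using A(2)[of v] that by simp
      then show ?thesis using A(1) by (simp add: mult_le_0_iff)
    qed
    then show ?thesis by (simp add: invertible_complex_iff)
  qed
  have constants: "frame_constants ?\<mu> UNIV (exp_family \<delta>) ?A ?B" if "invertible ?\<Gamma>"
    unfolding frame_constants_exp_family_iff[OF assms]
    by (simp add: Min_singular_values_pos[OF that] Max_singular_values_pos[OF that] singular_value_bounds(3,4))
  have basis: "is_riesz_basis ?\<mu> UNIV (exp_family \<delta>)" if "invertible ?\<Gamma>"
    using constants[OF that] is_riesz_sequence_exp_family[OF assms that]
    by (auto simp: is_riesz_basis_def is_frame_def is_riesz_sequence_def)
  have optimal: "A \<le> ?A \<and> ?B \<le> B" if AB: "frame_constants ?\<mu> UNIV (exp_family \<delta>) A B" for A B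
  proof -
    \<comment> \<open>At a singular vector for s the quotient |Gamma v|^2 / |v|^2 equals s, so every
      singular value lies between any pair of frame constants. Taking s to be the minimum and the
      maximum gives optimality.\<close>
    have bounds: "A \<le> s \<and> s \<le> B" if s: "s \<in> singular_values ?\<Gamma>" for s
    proof -
      obtain v where v: "v \<noteq> 0" "conj_transpose ?\<Gamma> *v (?\<Gamma> *v v) = s *\<^sub>R v"
        using s by (auto simp: singular_values_iff)
      have "A * (norm v)\<^sup>2 \<le> s * (norm v)\<^sup>2 \<and> s * (norm v)\<^sup>2 \<le> B * (norm v)\<^sup>2"
        using AB unfolding norm_matrix_singular_vector[OF v(2), symmetric]
        by (simp add: frame_constants_exp_family_iff[OF assms])
      then show ?thesis using v(1) by simp
    qed
    then show ?thesis using singular_value_bounds(1,2) by blast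
  qed
  show ?thesis
    using invertible basis constants optimal unfolding optimal_frame_constants_def by blast
qed

end
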